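(* For any profinite group $G$ in the class $\mathfrak{B}$, there is a positive integer $N$ such that $G$ embeds as a closed subgroup of $\Sigma_N\ltimes\hat{\mathbb{Z}}^N$ (that is, there is a continuous injective homomorphism $G\to\Sigma_N\ltimes\hat{\mathbb{Z}}^N$ that is a homeomorphism onto a closed subgroup).
   Context: A profinite group is called virtually finitely generated abelian if it contains a closed topologically finitely generated abelian subgroup of finite index. $\mathfrak{B}$ denotes the class of all torsion free, virtually finitely generated abelian profinite groups. $\Sigma_N$ is the symmetric group on $N$ letters, with the discrete topology; $\hat{\mathbb{Z}}$ is the profinite completion of $\mathbb{Z}$; $\Sigma_N\ltimes\hat{\mathbb{Z}}^N$ is the semidirect product in which $\Sigma_N$ acts on $\hat{\mathbb{Z}}^N$ by permuting the factors, topologized as the product space $\Sigma_N\times\hat{\mathbb{Z}}^N$; it is a profinite group. *)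

theory Defs
  imports "HOL-Analysis.Analysis" "HOL-Algebra.Product_Groups" "HOL-Algebra.Sym_Groups"
begin

subsection \<open>Profinite groups\<close>

text \<open>A topological group is given by a group \<open>G\<close> together with a topology \<open>T\<close> on its carrier.\<close>

definition topological_group :: "('a, 'b) monoid_scheme \<Rightarrow> 'a topology \<Rightarrow> bool" where
  "topological_group G T \<longleftrightarrow>
     group G \<and> topspace T = carrier G \<and>
     continuous_map (prod_topology T T) T (\<lambda>(x, y). x \<otimes>\<^bsub>G\<^esub> y) \<and>
     continuous_map T T (\<lambda>x. inv\<^bsub>G\<^esub> x)"

definition totally_disconnected_space :: "'a topology \<Rightarrow> bool" where
  "totally_disconnected_space T \<longleftrightarrow> (\<forall>C. connectedin T C \<longrightarrow> (\<exists>x. C \<subseteq> {x}))"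

definition profinite_group :: "('a, 'b) monoid_scheme \<Rightarrow> 'a topology \<Rightarrow> bool" where
  "profinite_group G T \<longleftrightarrow>
     topological_group G T \<and> compact_space T \<and> Hausdorff_space T \<and> totally_disconnected_space T"

definition topologically_finitely_generated ::
    "('a, 'b) monoid_scheme \<Rightarrow> 'a topology \<Rightarrow> bool" where
  "topologically_finitely_generated G T \<longleftrightarrow>
     (\<exists>S. finite S \<and> S \<subseteq> carrier G \<and> T closure_of (generate G S) = carrier G)"

definition torsion_free :: "('a, 'b) monoid_scheme \<Rightarrow> bool" where
  "torsion_free G \<longleftrightarrow>
     (\<forall>x \<in> carrier G. \<forall>n::nat. n > 0 \<longrightarrow> x [^]\<^bsub>G\<^esub> n = \<one>\<^bsub>G\<^esub> \<longrightarrow> x = \<one>\<^bsub>G\<^esub>)"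

definition virtually_fg_abelian :: "('a, 'b) monoid_scheme \<Rightarrow> 'a topology \<Rightarrow> bool" where
  "virtually_fg_abelian G T \<longleftrightarrow>
     (\<exists>A. subgroup A G \<and> closedin T A \<and> finite (rcosets\<^bsub>G\<^esub> A) \<and>
          comm_group (G\<lparr>carrier := A\<rparr>) \<and>
          topologically_finitely_generated (G\<lparr>carrier := A\<rparr>) (subtopology T A))"

definition class_B :: "('a, 'b) monoid_scheme \<Rightarrow> 'a topology \<Rightarrow> bool" where
  "class_B G T \<longleftrightarrow> profinite_group G T \<and> torsion_free G \<and> virtually_fg_abelian G T"


subsection \<open>Profinite completion\<close>

definition finite_index_normal :: "('a, 'b) monoid_scheme \<Rightarrow> 'a set set" where
  "finite_index_normal G = {N. N \<lhd> G \<and> finite (rcosets\<^bsub>G\<^esub> N)}"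

text \<open>
  The profinite completion is the inverse limit of the quotients \<open>G Mod N\<close>, realised inside
  their product. For \<open>M \<subseteq> N\<close> the transition map \<open>G Mod M \<rightarrow> G Mod N\<close> sends a coset of \<open>M\<close> to
  the unique coset of \<open>N\<close> that contains it, so compatibility of a family \<open>x\<close> reads
  \<open>x M \<subseteq> x N\<close>.
\<close>

definition profinite_completion :: "('a, 'b) monoid_scheme \<Rightarrow> ('a set \<Rightarrow> 'a set) monoid" where
  "profinite_completion G =
     (product_group (finite_index_normal G) (\<lambda>N. G Mod N))
       \<lparr>carrier := {x \<in> (\<Pi>\<^sub>E N \<in> finite_index_normal G. carrier (G Mod N)).
          \<forall>M \<in> finite_index_normal G. \<forall>N \<in> finite_index_normal G. M \<subseteq> N \<longrightarrow> x M \<subseteq> x N}\<rparr>"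

definition profinite_completion_topology ::
    "('a, 'b) monoid_scheme \<Rightarrow> ('a set \<Rightarrow> 'a set) topology" where
  "profinite_completion_topology G =
     subtopology
       (product_topology (\<lambda>N. discrete_topology (carrier (G Mod N))) (finite_index_normal G))
       (carrier (profinite_completion G))"

definition Zhat :: "(int set \<Rightarrow> int set) monoid" where
  "Zhat = profinite_completion integer_group"

definition Zhat_topology :: "(int set \<Rightarrow> int set) topology" where
  "Zhat_topology = profinite_completion_topology integer_group"


subsection \<open>The semidirect product of \<open>\<Sigma>\<^sub>N\<close> and the \<open>N\<close>-th power of \<open>Zhat\<close>\<close>

definition semidirect_product ::
    "('a, 'c) monoid_scheme \<Rightarrow> ('b, 'd) monoid_scheme \<Rightarrow> ('a \<Rightarrow> 'b \<Rightarrow> 'b) \<Rightarrow> ('a \<times> 'b) monoid" where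
  "semidirect_product K H \<phi> =
     \<lparr>carrier = carrier K \<times> carrier H,
      mult = (\<lambda>(k, h) (k', h'). (k \<otimes>\<^bsub>K\<^esub> k', h \<otimes>\<^bsub>H\<^esub> \<phi> k h')),
      one = (\<one>\<^bsub>K\<^esub>, \<one>\<^bsub>H\<^esub>)\<rparr>"

text \<open>
  The inverse makes this a left action: \<open>\<sigma>\<close> moves the entry in position \<open>j\<close> to position \<open>\<sigma> j\<close>.
\<close>

definition permute_factors :: "nat \<Rightarrow> (nat \<Rightarrow> nat) \<Rightarrow> (nat \<Rightarrow> 'a) \<Rightarrow> nat \<Rightarrow> 'a" where
  "permute_factors N \<sigma> a = (\<lambda>i\<in>{1..N}. a (inv_into UNIV \<sigma> i))"

definition Sigma_Zhat :: "nat \<Rightarrow> ((nat \<Rightarrow> nat) \<times> (nat \<Rightarrow> int set \<Rightarrow> int set)) monoid" where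
  "Sigma_Zhat N =
     semidirect_product (sym_group N) (product_group {1..N} (\<lambda>_. Zhat)) (permute_factors N)"

definition Sigma_Zhat_topology ::
    "nat \<Rightarrow> ((nat \<Rightarrow> nat) \<times> (nat \<Rightarrow> int set \<Rightarrow> int set)) topology" where
  "Sigma_Zhat_topology N =
     prod_topology (discrete_topology (carrier (sym_group N)))
       (product_topology (\<lambda>_. Zhat_topology) {1..N})"

end

theory Submission
  imports Defs "HOL-Algebra.FiniteProduct" "HOL-Number_Theory.Cong"
begin

text \<open>
  Let \<open>A\<close> be a closed, topologically finitely generated abelian subgroup of finite index in \<open>G\<close>. The
  embedding is induced from \<open>A\<close>, in the sense of monomial representations.

  The heart of the matter is that finitely many continuous homomorphisms from \<open>A\<close> to \<open>Zhat\<close> separate the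
  points of \<open>A\<close> (\<open>torsion_free_fg_abelian_separated_by_Zhat\<close>). Fix a finite set \<open>S\<close> of topological
  generators and, for each prime \<open>p\<close>, a minimal subset of \<open>S\<close> that still generates \<open>A\<close> modulo \<open>p\<close>-th
  powers. Minimality makes it independent modulo \<open>p\<close>, and since \<open>A\<close> has no torsion, it is a basis of
  the quotient of \<open>A\<close> by \<open>p\<^sup>k\<close>-th powers over the integers modulo \<open>p\<^sup>k\<close>, for every \<open>k\<close>
  (\<open>basis_spans_power\<close>, \<open>basis_independent_power\<close>). So every element has well-defined coordinates
  modulo each prime power, and by the Chinese remainder theorem modulo each \<open>n\<close> (\<open>ex_coords\<close>,
  \<open>coords_unique\<close>). The coordinates modulo the various \<open>n\<close> are compatible, and the coordinate at each
  \<open>s\<close> in \<open>S\<close> defines a homomorphism to \<open>Zhat\<close>. An element killed by all of them is an \<open>n\<close>-th power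
  for every \<open>n > 0\<close>, and in a profinite group only the identity has this property
  (\<open>profinite_infinitely_divisible_imp_one\<close>).

  Now choose representatives of the right cosets of \<open>A\<close> in \<open>G\<close>. An element \<open>x\<close> of \<open>G\<close> permutes the
  cosets, and comparing the translated representatives with the chosen ones gives one element of \<open>A\<close> for
  each coset. Applying the homomorphisms to these elements yields a vector over \<open>Zhat\<close> indexed by pairs of
  a generator and a coset; permutation and vector together form the image of \<open>x\<close> (\<open>induced_hom\<close>,
  \<open>induced_inj\<close>, \<open>continuous_map_induced\<close>). Since \<open>G\<close> is compact and the target Hausdorff, an injective
  continuous homomorphism is automatically a homeomorphism onto a closed subgroup.
\<close>

text \<open>
  Coordinates modulo \<open>n\<close> are assembled from coordinates modulo prime powers, and so are \<open>n\<close>-th roots;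
  both arguments run along this induction.
\<close>

lemma coprime_factor_induct [consumes 1, case_names one prime_power mult]:
  fixes n :: int
  assumes "n > 0" and one: "P 1"
    and prime_power: "\<And>p k. prime p \<Longrightarrow> P (p ^ k)"
    and mult: "\<And>a b. a > 0 \<Longrightarrow> b > 0 \<Longrightarrow> coprime a b \<Longrightarrow> P a \<Longrightarrow> P b \<Longrightarrow> P (a * b)"
  shows "P n"
  using \<open>n > 0\<close>
proof (induction "nat n" arbitrary: n rule: less_induct)
  case less
  show ?case
  proof (cases "n = 1")
    case True then show ?thesis using one by simp
  next
    case False
    with less.prems have "\<not> is_unit n" by auto
    then obtain p where p: "prime p" "p dvd n"
      using less.prems prime_divisor_exists[of n] by auto
    define k where "k = multiplicity p n"
    obtain m where m: "n = p ^ k * m" "\<not> p dvd m"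
      using multiplicity_decompose'[of n p] less.prems p unfolding k_def by (metis not_prime_unit order_less_irrefl)
    have "k > 0"
      using p m by (cases k) auto
    have "p > 1" using p prime_gt_1_int by blast
    have "m > 0" using m less.prems \<open>p > 1\<close>
      by (simp add: zero_less_mult_iff)
    have "p ^ k > 1" using \<open>p > 1\<close> \<open>k > 0\<close> by (simp add: one_less_power)
    then have "m < n" using \<open>m > 0\<close> m by simp
    then have "P m" using less \<open>m > 0\<close> by simp
    moreover have "coprime (p ^ k) m"
      using p m by (simp add: prime_imp_coprime)
    ultimately show ?thesis
      using mult[of "p ^ k" m] prime_power[OF p(1)] m \<open>m > 0\<close> \<open>p > 1\<close> by simp
  qed
qed

section \<open>Coordinates in torsion-free abelian groups\<close>

context comm_group
begin

definition monomial :: "'a set \<Rightarrow> ('a \<Rightarrow> int) \<Rightarrow> 'a" where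
  "monomial B c = (\<Otimes>s\<in>B. s [^] c s)"

lemma monomial_closed [simp]: "B \<subseteq> carrier G \<Longrightarrow> monomial B c \<in> carrier G"
  unfolding monomial_def by (rule finprod_closed) auto

lemma monomial_add:
  "B \<subseteq> carrier G \<Longrightarrow> monomial B (\<lambda>s. c s + d s) = monomial B c \<otimes> monomial B d"
proof -
  assume B: "B \<subseteq> carrier G"
  have "monomial B (\<lambda>s. c s + d s) = (\<Otimes>s\<in>B. s [^] c s \<otimes> s [^] d s)"
    unfolding monomial_def using B by (intro finprod_cong') (auto simp: int_pow_mult)
  also have "\<dots> = monomial B c \<otimes> monomial B d"
    unfolding monomial_def using B by (intro finprod_multf) auto
  finally show ?thesis .
qed

lemma monomial_zero [simp]: "monomial B (\<lambda>s. 0) = \<one>"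
  unfolding monomial_def by (simp add: int_pow_0)

lemma monomial_cong:
  "B \<subseteq> carrier G \<Longrightarrow> (\<And>s. s \<in> B \<Longrightarrow> c s = d s) \<Longrightarrow> monomial B c = monomial B d"
  unfolding monomial_def by (rule finprod_cong') auto

lemma monomial_mult:
  assumes "finite B" "B \<subseteq> carrier G"
  shows "monomial B (\<lambda>s. c s * n) = monomial B c [^] n"
  using assms
proof (induction B rule: finite_induct)
  case empty then show ?case by (simp add: monomial_def)
next
  case (insert b B)
  then have "(\<lambda>s. s [^] d s) \<in> B \<rightarrow> carrier G" for d :: "'a \<Rightarrow> int" by auto
  with insert show ?case
    unfolding monomial_def by (simp add: int_pow_distrib int_pow_pow)
qed

lemma monomial_minus:
  assumes "finite B" "B \<subseteq> carrier G"
  shows "monomial B (\<lambda>s. - c s) = inv (monomial B c)"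
  using monomial_mult[OF assms, of c "-1"] assms(2) by (simp add: int_pow_neg)

lemma monomial_remove:
  assumes "finite B" "B \<subseteq> carrier G" "t \<in> B"
  shows "monomial B c = t [^] c t \<otimes> monomial (B - {t}) c"
proof -
  have "(\<lambda>s. s [^] c s) \<in> B - {t} \<rightarrow> carrier G" using assms by auto
  then have "monomial (insert t (B - {t})) c = t [^] c t \<otimes> monomial (B - {t}) c"
    unfolding monomial_def using assms by (subst finprod_insert) auto
  then show ?thesis using assms(3) by (simp add: insert_absorb)
qed

lemma generate_subset_monomials:
  assumes "finite S" "S \<subseteq> carrier G"
  shows "generate G S \<subseteq> range (monomial S)"
proof
  have one: "s = monomial S (\<lambda>u. if u = s then 1 else 0)" if "s \<in> S" for s
  proof -
    have "monomial (S - {s}) (\<lambda>u. if u = s then 1 else 0) = monomial (S - {s}) (\<lambda>_. 0)"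
      using assms by (intro monomial_cong) auto
    then show ?thesis
      using monomial_remove[OF assms that, of "\<lambda>u. if u = s then 1 else 0"] assms that by auto
  qed
  fix x assume "x \<in> generate G S"
  then show "x \<in> range (monomial S)"
  proof (induction rule: generate.induct)
    case one then show ?case by (metis monomial_zero rangeI)
  next
    case (incl h) then show ?case using one by blast
  next
    case (inv h) then show ?case using one monomial_minus[OF assms] by (metis rangeI)
  next
    case (eng h1 h2)
    then obtain c d where "h1 = monomial S c" "h2 = monomial S d" by blast
    then show ?case using monomial_add[OF assms(2), of c d] by (metis rangeI)
  qed
qed

end

text \<open>
  The algebraic shadow of a torsion-free topologically finitely generated abelian profinite group:
  a fixed finite set \<open>S\<close> generates every quotient \<open>G / G\<^sup>n\<close>. Topological generators have
  this property because \<open>G\<^sup>n\<close> is open, so the dense subgroup generated by \<open>S\<close> meets every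
  coset of \<open>G\<^sup>n\<close>.
\<close>

locale torsion_free_generated_mod = comm_group G for G (structure) +
  fixes S :: "'a set"
  assumes finite_gens: "finite S" and gens_closed: "S \<subseteq> carrier G"
    and torsion_free: "\<And>x n. \<lbrakk>x \<in> carrier G; n > 0; x [^] (n::int) = \<one>\<rbrakk> \<Longrightarrow> x = \<one>"
    and generates_mod:
      "\<And>n x. \<lbrakk>n > 0; x \<in> carrier G\<rbrakk> \<Longrightarrow> \<exists>c. \<exists>y\<in>carrier G. x = monomial S c \<otimes> y [^] (n::int)"
begin

lemma pow_inj:
  assumes "x \<in> carrier G" "y \<in> carrier G" "n > 0" "x [^] (n::int) = y [^] n"
  shows "x = y"
proof -
  have "(x \<otimes> inv y) [^] n = x [^] n \<otimes> inv (y [^] n)"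
    using assms by (simp add: int_pow_distrib int_pow_inv)
  also have "\<dots> = \<one>" using assms by simp
  finally have "x \<otimes> inv y = \<one>" using torsion_free assms by simp
  then show ?thesis using assms inv_equality by fastforce
qed

definition spans :: "int \<Rightarrow> 'a set \<Rightarrow> bool" where
  "spans p B \<longleftrightarrow> (\<forall>x\<in>carrier G. \<exists>c. \<exists>y\<in>carrier G. x = monomial B c \<otimes> y [^] p)"

lemma ex_basis:
  assumes "prime p"
  shows "\<exists>B\<subseteq>S. spans p B \<and> (\<forall>t\<in>B. \<not> spans p (B - {t}))"
proof -
  have "p > 0" using assms prime_gt_0_int by blast
  then have "S \<subseteq> S \<and> spans p S" unfolding spans_def using generates_mod by blast
  from ex_has_least_nat[where P="\<lambda>B. B \<subseteq> S \<and> spans p B" and m=card, OF this]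
  obtain B where B: "B \<subseteq> S" "spans p B"
    and min: "\<And>C. C \<subseteq> S \<Longrightarrow> spans p C \<Longrightarrow> card B \<le> card C" by blast
  have "\<not> spans p (B - {t})" if "t \<in> B" for t
  proof
    assume "spans p (B - {t})"
    then have "card B \<le> card (B - {t})" using min B by blast
    moreover have "card (B - {t}) < card B"
      using that B finite_gens by (meson card_Diff1_less finite_subset)
    ultimately show False by simp
  qed
  with B show ?thesis by blast
qed

text \<open>
  For each prime \<open>p\<close> a minimal subset of \<open>S\<close> that still generates \<open>G / G\<^sup>p\<close>. It has to depend on
  \<open>p\<close>: a group such as the direct product of \<open>Zhat\<close> and the 2-adic integers has different ranks
  at different primes.
\<close>

definition basis :: "int \<Rightarrow> 'a set" where
  "basis p = (SOME B. B \<subseteq> S \<and> spans p B \<and> (\<forall>t\<in>B. \<not> spans p (B - {t})))"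

lemma basis:
  assumes "prime p"
  shows "basis p \<subseteq> S" "spans p (basis p)" "\<And>t. t \<in> basis p \<Longrightarrow> \<not> spans p (basis p - {t})"
  using someI_ex[OF ex_basis[OF assms, unfolded Bex_def[symmetric]]] unfolding basis_def by blast+

lemma basis_closed: "prime p \<Longrightarrow> basis p \<subseteq> carrier G"
  and finite_basis: "prime p \<Longrightarrow> finite (basis p)"
  using basis(1) gens_closed finite_gens finite_subset by blast+

text \<open>
  If \<open>p\<close> did not divide the exponent of \<open>t\<close>, that exponent would be invertible modulo \<open>p\<close> and the
  relation could be solved for \<open>t\<close>, so that \<open>t\<close> could be dropped from the minimal generating set.
\<close>

lemma basis_independent:
  assumes p: "prime p" and y: "y \<in> carrier G" and eq: "monomial (basis p) c = y [^] p"
    and t: "t \<in> basis p"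
  shows "p dvd c t"
proof (rule ccontr)
  assume "\<not> p dvd c t"
  then have "coprime (c t) p" using p by (simp add: prime_imp_coprime coprime_commute)
  then obtain u where "[c t * u = 1] (mod p)" using cong_solve_coprime_int by blast
  then obtain w where w: "c t * u - 1 = p * w" by (metis cong_iff_dvd_diff dvd_def)
  note B = finite_basis[OF p] basis_closed[OF p]
  let ?B = "basis p"
  have tG: "t \<in> carrier G" using t B by blast
  have "spans p (?B - {t})"
    unfolding spans_def
  proof
    fix x assume x: "x \<in> carrier G"
    then obtain d z where z: "z \<in> carrier G" and xd: "x = monomial ?B d \<otimes> z [^] p"
      using basis(2)[OF p] unfolding spans_def by blast
    \<comment> \<open>Multiplying \<open>x\<close> by the \<open>k\<close>-th power of the relation makes the exponent of \<open>t\<close> divisible by \<open>p\<close>,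
      so that the factor \<open>t\<close> can be absorbed into the \<open>p\<close>-th power.\<close>
    define k where "k = - d t * u"
    define e where "e = (\<lambda>s. d s + c s * k)"
    have "e t = - (d t * (c t * u - 1))" unfolding e_def k_def by (simp add: algebra_simps)
    then have et: "e t = (- d t * w) * p" by (simp add: w)
    have "monomial ?B e = monomial ?B d \<otimes> (y [^] p) [^] k"
      unfolding e_def using B by (simp add: monomial_add monomial_mult eq)
    then have "monomial ?B d = monomial ?B e \<otimes> inv ((y [^] k) [^] p)"
      using B y by (simp add: int_pow_pow mult.commute m_assoc)
    also have "\<dots> = monomial (?B - {t}) e \<otimes> (t [^] (- d t * w) \<otimes> inv (y [^] k)) [^] p"
      using monomial_remove[OF B t, of e] tG y B
        monomial_closed[of "?B - {t}" e]
      by (simp add: et int_pow_distrib int_pow_pow int_pow_inv m_ac subset_iff)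
    finally have "x = monomial (?B - {t}) e \<otimes> ((t [^] (- d t * w) \<otimes> inv (y [^] k)) \<otimes> z) [^] p"
      using xd z tG y B monomial_closed[of "?B - {t}" e]
      by (simp add: int_pow_distrib m_assoc subset_iff)
    then show "\<exists>c. \<exists>y\<in>carrier G. x = monomial (?B - {t}) c \<otimes> y [^] p"
      using z tG y by blast
  qed
  then show False using basis(3)[OF p t] by blast
qed

text \<open>
  Nakayama's argument: the error term \<open>y\<close> of an expansion modulo \<open>p\<^sup>k\<close> can itself be expanded modulo \<open>p\<close>.
\<close>

lemma basis_spans_power:
  assumes p: "prime p" and x: "x \<in> carrier G"
  shows "\<exists>c. \<exists>y\<in>carrier G. x = monomial (basis p) c \<otimes> y [^] (p ^ k)"
proof (induction k)
  case 0
  show ?case using x by (intro exI[of _ "\<lambda>_. 0"] bexI[of _ x]) auto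
next
  case (Suc k)
  note B = finite_basis[OF p] basis_closed[OF p]
  from Suc obtain c y where y: "y \<in> carrier G" and xc: "x = monomial (basis p) c \<otimes> y [^] (p ^ k)"
    by blast
  obtain d z where z: "z \<in> carrier G" and yd: "y = monomial (basis p) d \<otimes> z [^] p"
    using basis(2)[OF p] y unfolding spans_def by blast
  have "y [^] (p ^ k) = monomial (basis p) (\<lambda>s. d s * p ^ k) \<otimes> z [^] (p ^ Suc k)"
    using B z by (simp add: yd int_pow_distrib int_pow_pow monomial_mult)
  then have "x = monomial (basis p) (\<lambda>s. c s + d s * p ^ k) \<otimes> z [^] (p ^ Suc k)"
    using B z by (simp add: xc monomial_add m_assoc)
  then show ?case using z by blast
qed

text \<open>
  This is where torsion-freeness enters. All exponents of the relation are divisible by \<open>p\<close>, and the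
  injectivity of \<open>p\<close>-th powers allows the whole relation to be divided by \<open>p\<close>. Together with the
  preceding lemma it says that \<open>G / G\<^bsup>p^k\<^esup>\<close> is a free module over the integers modulo \<open>p\<^sup>k\<close> on
  the same basis for all \<open>k\<close>.
\<close>

lemma basis_independent_power:
  assumes p: "prime p" and "y \<in> carrier G" "monomial (basis p) c = y [^] (p ^ k)" "t \<in> basis p"
  shows "p ^ k dvd c t"
  using assms(2-)
proof (induction k arbitrary: c y)
  case 0 then show ?case by simp
next
  case (Suc k)
  note B = finite_basis[OF p] basis_closed[OF p]
  have p0: "p > 0" using p prime_gt_0_int by blast
  have e: "monomial (basis p) c = (y [^] (p ^ k)) [^] p"
    using Suc.prems by (simp add: int_pow_pow mult.commute)
  then have dv: "p dvd c s" if "s \<in> basis p" for s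
    using basis_independent[OF p _ e that] Suc.prems by simp
  define d where "d = (\<lambda>s. c s div p)"
  have "monomial (basis p) c = monomial (basis p) (\<lambda>s. d s * p)"
    using B dv by (intro monomial_cong) (auto simp: d_def)
  also have "\<dots> = monomial (basis p) d [^] p" using B by (simp add: monomial_mult)
  finally have "monomial (basis p) d = y [^] (p ^ k)"
    using e pow_inj[OF _ _ p0] B Suc.prems by simp
  then have "p ^ k dvd d t" using Suc by blast
  then show ?case using dv[OF Suc.prems(3)] p0 by (auto simp: d_def dvd_div_iff_mult mult.commute)
qed

text \<open>
  \<open>c\<close> is a coordinate vector of \<open>x\<close> modulo \<open>n\<close> if, for every prime power dividing \<open>n\<close>, it gives the
  expansion of \<open>x\<close> in the basis belonging to that prime and vanishes outside this basis. Requiring the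
  condition for all prime powers, and not only for the maximal ones, makes the passage from \<open>n\<close> to a
  divisor of \<open>n\<close> trivial. As shown below, coordinates exist and are unique as vectors modulo \<open>n\<close>,
  depend additively on \<open>x\<close>, and vanish exactly on \<open>n\<close>-th powers.
\<close>

definition coords :: "int \<Rightarrow> 'a \<Rightarrow> ('a \<Rightarrow> int) \<Rightarrow> bool" where
  "coords n x c \<longleftrightarrow> (\<forall>p k. prime p \<longrightarrow> p ^ k dvd n \<longrightarrow>
     (\<exists>y\<in>carrier G. x = monomial (basis p) c \<otimes> y [^] (p ^ k)) \<and> (\<forall>s\<in>S - basis p. p ^ k dvd c s))"

lemma coords_mono: "coords n x c \<Longrightarrow> m dvd n \<Longrightarrow> coords m x c"
  unfolding coords_def by (meson dvd_trans)

lemma coords_mult: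
  assumes "coords n x c" "coords n y d"
  shows "coords n (x \<otimes> y) (\<lambda>s. c s + d s)"
  unfolding coords_def
proof (intro allI impI)
  fix p :: int and k assume pk: "prime p" "p ^ k dvd n"
  note B = basis_closed[OF pk(1)]
  obtain u where u: "u \<in> carrier G" "x = monomial (basis p) c \<otimes> u [^] (p ^ k)"
    using assms(1) pk unfolding coords_def by blast
  obtain v where v: "v \<in> carrier G" "y = monomial (basis p) d \<otimes> v [^] (p ^ k)"
    using assms(2) pk unfolding coords_def by blast
  have "u \<otimes> v \<in> carrier G" 
    "x \<otimes> y = monomial (basis p) (\<lambda>s. c s + d s) \<otimes> (u \<otimes> v) [^] (p ^ k)"
    using B u v by (simp_all add: monomial_add int_pow_distrib m_ac)
  then show "(\<exists>z\<in>carrier G. x \<otimes> y = monomial (basis p) (\<lambda>s. c s + d s) \<otimes> z [^] (p ^ k)) \<and>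
      (\<forall>s\<in>S - basis p. p ^ k dvd c s + d s)"
    using assms pk unfolding coords_def by (metis dvd_add)
qed

lemma coords_inv:
  assumes "coords n x c"
  shows "coords n (inv x) (\<lambda>s. - c s)"
  unfolding coords_def
proof (intro allI impI)
  fix p :: int and k assume pk: "prime p" "p ^ k dvd n"
  note B = finite_basis[OF pk(1)] basis_closed[OF pk(1)]
  obtain u where "u \<in> carrier G" "x = monomial (basis p) c \<otimes> u [^] (p ^ k)"
    using assms pk unfolding coords_def by blast
  then have "inv u \<in> carrier G" 
    "inv x = monomial (basis p) (\<lambda>s. - c s) \<otimes> (inv u) [^] (p ^ k)"
    using B by (simp_all add: monomial_minus inv_mult int_pow_inv)
  then show "(\<exists>z\<in>carrier G. inv x = monomial (basis p) (\<lambda>s. - c s) \<otimes> z [^] (p ^ k)) \<and>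
      (\<forall>s\<in>S - basis p. p ^ k dvd - c s)"
    using assms pk unfolding coords_def by (metis dvd_minus_iff)
qed

lemma coords_power:
  assumes "x \<in> carrier G"
  shows "coords n (x [^] n) (\<lambda>_. 0)"
  unfolding coords_def
proof (intro allI impI)
  fix p :: int and k assume pk: "prime p" "p ^ k dvd n"
  then obtain m where "n = m * p ^ k" by (metis dvd_def mult.commute)
  then have "x [^] n = (x [^] m) [^] (p ^ k)" using assms by (simp add: int_pow_pow)
  then show "(\<exists>z\<in>carrier G. x [^] n = monomial (basis p) (\<lambda>_. 0) \<otimes> z [^] (p ^ k)) \<and>
      (\<forall>s\<in>S - basis p. p ^ k dvd 0)"
    using assms by (intro conjI bexI[of _ "x [^] m"]) auto
qed

lemma coords_cong:
  assumes xc: "coords n x c" and cong: "\<And>s. s \<in> S \<Longrightarrow> [c s = d s] (mod n)"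
  shows "coords n x d"
  unfolding coords_def
proof (intro allI impI)
  fix p :: int and k assume pk: "prime p" "p ^ k dvd n"
  note B = finite_basis[OF pk(1)] basis_closed[OF pk(1)] basis(1)[OF pk(1)]
  obtain u where u: "u \<in> carrier G" and x: "x = monomial (basis p) c \<otimes> u [^] (p ^ k)"
    using xc pk unfolding coords_def by blast
  have dv: "p ^ k dvd c s - d s" if "s \<in> S" for s
    using cong[OF that] pk(2) by (metis cong_iff_dvd_diff dvd_trans)
  define e where "e s = (c s - d s) div p ^ k" for s
  have "monomial (basis p) c = monomial (basis p) (\<lambda>s. d s + e s * p ^ k)"
    using B dv by (intro monomial_cong) (auto simp: e_def subset_iff)
  also have "\<dots> = monomial (basis p) d \<otimes> monomial (basis p) e [^] (p ^ k)"
    using B by (simp add: monomial_add monomial_mult)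
  finally have "x = monomial (basis p) d \<otimes> (monomial (basis p) e \<otimes> u) [^] (p ^ k)"
    using x u B by (simp add: int_pow_distrib m_assoc)
  moreover have "p ^ k dvd d s" if "s \<in> S - basis p" for s
    using dv[of s] that xc pk unfolding coords_def by (metis DiffD1 dvd_diff diff_diff_eq2 add_diff_cancel_left')
  ultimately show "(\<exists>z\<in>carrier G. x = monomial (basis p) d \<otimes> z [^] (p ^ k)) \<and>
      (\<forall>s\<in>S - basis p. p ^ k dvd d s)"
    using u B by (metis m_closed monomial_closed)
qed

text \<open>
  For a prime power this is the expansion in the basis; coprime moduli are glued by the Chinese remainder
  theorem, entry by entry.
\<close>

lemma ex_coords:
  assumes "n > 0" and x: "x \<in> carrier G"
  shows "\<exists>c. coords n x c"
  using \<open>n > 0\<close>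
proof (induction n rule: coprime_factor_induct)
  show "\<exists>c. coords 1 x c"
    using coords_power[OF x, of 1] x by (auto simp: int_pow_1)
next
  fix p :: int and k assume p: "prime p"
  obtain c y where y: "y \<in> carrier G" and xc: "x = monomial (basis p) c \<otimes> y [^] (p ^ k)"
    using basis_spans_power[OF p x] by blast
  define d where "d s = (if s \<in> basis p then c s else 0)" for s
  have "monomial (basis p) c = monomial (basis p) d"
    using basis_closed[OF p] by (intro monomial_cong) (auto simp: d_def)
  with xc have xd: "x = monomial (basis p) d \<otimes> y [^] (p ^ k)" by simp
  have "coords (p ^ k) x d"
    unfolding coords_def
  proof (intro allI impI)
    fix q :: int and l assume q: "prime q" "q ^ l dvd p ^ k"
    show "(\<exists>z\<in>carrier G. x = monomial (basis q) d \<otimes> z [^] (q ^ l)) \<and> (\<forall>s\<in>S - basis q. q ^ l dvd d s)"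
    proof (cases "l = 0")
      case True
      \<comment> \<open>A first power can absorb any discrepancy, whatever the prime \<open>q\<close>.\<close>
      have "x = monomial (basis q) d \<otimes> (inv (monomial (basis q) d) \<otimes> x)"
        using x basis_closed[OF q(1)] by (simp add: m_assoc[symmetric])
      then show ?thesis using x True basis_closed[OF q(1)]
        by (auto simp: int_pow_1 intro!: bexI[of _ "inv (monomial (basis q) d) \<otimes> x"])
    next
      case False
      then have "q dvd p ^ k" using q by (meson dvd_power dvd_trans neq0_conv)
      then have "q = p" using q p by (meson prime_dvd_power primes_dvd_imp_eq)
      then obtain m where m: "p ^ k = m * q ^ l" using q(2) by (metis dvd_def mult.commute)
      then have "y [^] (p ^ k) = (y [^] m) [^] (q ^ l)" using y by (simp add: int_pow_pow)
      then show ?thesis using xd y \<open>q = p\<close>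
        by (auto simp: d_def intro!: bexI[of _ "y [^] m"])
    qed
  qed
  then show "\<exists>c. coords (p ^ k) x c" by blast
next
  fix a b :: int assume ab: "coprime a b" and "\<exists>c. coords a x c" "\<exists>c. coords b x c"
  then obtain c d where cd: "coords a x c" "coords b x d" by blast
  have "\<forall>s. \<exists>e. [e = c s] (mod a) \<and> [e = d s] (mod b)"
    using binary_chinese_remainder_int[OF ab] by blast
  then obtain e where e: "\<And>s. [e s = c s] (mod a)" "\<And>s. [e s = d s] (mod b)" by metis
  have "coords a x e" "coords b x e"
    using cd e by (meson coords_cong cong_sym)+
  moreover have "p ^ k dvd a \<or> p ^ k dvd b" if "prime p" "p ^ k dvd a * b" for p k
  proof -
    have "coprime p a \<or> coprime p b"
      using ab that(1) by (metis coprime_common_divisor not_prime_unit prime_imp_coprime)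
    then show ?thesis
      using that(2) by (metis coprime_dvd_mult_left_iff coprime_dvd_mult_right_iff coprime_power_left_iff)
  qed
  ultimately have "coords (a * b) x e" unfolding coords_def by blast
  then show "\<exists>c. coords (a * b) x c" by blast
qed

lemma coords_one:
  assumes "n > 0" and c: "coords n \<one> c" and s: "s \<in> S"
  shows "n dvd c s"
proof -
  have "p ^ k dvd c s" if pk: "prime p" "p ^ k dvd n" for p k
  proof (cases "s \<in> basis p")
    case True
    note B = basis_closed[OF pk(1)]
    obtain y where y: "y \<in> carrier G" "\<one> = monomial (basis p) c \<otimes> y [^] (p ^ k)"
      using c pk unfolding coords_def by blast
    then have "monomial (basis p) c = (inv y) [^] (p ^ k)"
      using B by (metis int_pow_closed int_pow_inv inv_equality monomial_closed)
    then show ?thesis using basis_independent_power[OF pk(1) _ _ True] y by blast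
  next
    case False then show ?thesis using c pk s unfolding coords_def by blast
  qed
  then have *: "\<forall>p k. prime p \<longrightarrow> p ^ k dvd n \<longrightarrow> p ^ k dvd c s" by blast
  show ?thesis
    using \<open>n > 0\<close> *
  proof (induction n rule: coprime_factor_induct)
    case (mult a b)
    then have "a dvd c s" "b dvd c s" by (meson dvd_mult dvd_mult2)+
    with mult show ?case by (simp add: divides_mult)
  qed auto
qed

lemma coords_unique:
  assumes "n > 0" "x \<in> carrier G" "coords n x c" "coords n x d" "s \<in> S"
  shows "[c s = d s] (mod n)"
proof -
  have "coords n (x \<otimes> inv x) (\<lambda>s. c s + - d s)"
    using assms coords_mult coords_inv by blast
  then show ?thesis
    using coords_one[OF assms(1) _ assms(5)] assms by (fastforce simp: cong_iff_dvd_diff)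
qed

text \<open>
  Vanishing coordinates provide a root of order \<open>p\<^sup>k\<close> for every prime power dividing \<open>n\<close>; Bezout
  coefficients combine roots of coprime orders.
\<close>

lemma coords_zero_imp_power:
  assumes "n > 0" and x: "x \<in> carrier G" and "coords n x (\<lambda>_. 0)"
  shows "\<exists>y\<in>carrier G. x = y [^] n"
  using assms(1,3)
proof (induction n rule: coprime_factor_induct)
  show "\<exists>y\<in>carrier G. x = y [^] (1::int)" using x by (metis int_pow_1)
next
  fix p :: int and k assume "prime p" "coords (p ^ k) x (\<lambda>_. 0)"
  then show "\<exists>y\<in>carrier G. x = y [^] (p ^ k)"
    unfolding coords_def by (metis dvd_refl int_pow_closed l_one monomial_zero)
next
  fix a b :: int
  assume ab: "coprime a b" and c: "coords (a * b) x (\<lambda>_. 0)"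
    and IH: "coords a x (\<lambda>_. 0) \<Longrightarrow> \<exists>y\<in>carrier G. x = y [^] a"
      "coords b x (\<lambda>_. 0) \<Longrightarrow> \<exists>y\<in>carrier G. x = y [^] b"
  obtain y z where y: "y \<in> carrier G" "x = y [^] a" and z: "z \<in> carrier G" "x = z [^] b"
    using IH coords_mono[OF c] by (meson dvd_triv_left dvd_triv_right)
  obtain u v where "u * a + v * b = 1"
    using ab bezout_int[of a b] by auto
  then have "x = x [^] (u * a) \<otimes> x [^] (v * b)"
    using x by (metis int_pow_1 int_pow_mult)
  also have "x [^] (u * a) = (z [^] u) [^] (a * b)"
    using z by (simp add: int_pow_pow mult_ac)
  also have "x [^] (v * b) = (y [^] v) [^] (a * b)"
    using y by (simp add: int_pow_pow mult_ac)
  finally have "x = (z [^] u \<otimes> y [^] v) [^] (a * b)"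
    using y z by (simp add: int_pow_distrib)
  then show "\<exists>y\<in>carrier G. x = y [^] (a * b)" using y z by blast
qed

end

section \<open>Homomorphisms to the profinite integers\<close>

lemma mem_r_coset_integer_group: "a \<in> N #>\<^bsub>integer_group\<^esub> b \<longleftrightarrow> a - b \<in> N"
  unfolding r_coset_def by (auto intro: bexI[of _ "a - b"])

lemma finite_index_normal_integer_group:
  "N \<in> finite_index_normal integer_group \<longleftrightarrow> (\<exists>n>0. N = {a. n dvd a})"
proof
  assume "\<exists>n>0. N = {a::int. n dvd a}"
  then obtain n :: int where n: "n > 0" "N = {a. n dvd a}" by blast
  interpret Z: comm_group integer_group by (rule abelian_integer_group)
  have "subgroup N integer_group"
    using n by (intro group.subgroupI) auto
  then have "N \<lhd> integer_group" by (rule Z.subgroup_imp_normal)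
  moreover have "rcosets\<^bsub>integer_group\<^esub> N \<subseteq> (\<lambda>a. N #>\<^bsub>integer_group\<^esub> a) ` {0..<n}"
  proof
    fix C assume "C \<in> rcosets\<^bsub>integer_group\<^esub> N"
    then obtain a where C: "C = N #>\<^bsub>integer_group\<^esub> a" unfolding RCOSETS_def by auto
    have "N #>\<^bsub>integer_group\<^esub> a = N #>\<^bsub>integer_group\<^esub> (a mod n)"
    proof (rule Z.repr_independence)
      show "a mod n \<in> N #>\<^bsub>integer_group\<^esub> a"
        using n by (simp add: mem_r_coset_integer_group mod_eq_dvd_iff[symmetric])
    qed (use \<open>subgroup N integer_group\<close> in auto)
    then show "C \<in> (\<lambda>a. N #>\<^bsub>integer_group\<^esub> a) ` {0..<n}" using C n by auto
  qed
  then have "finite (rcosets\<^bsub>integer_group\<^esub> N)" by (rule finite_subset) simp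
  ultimately show "N \<in> finite_index_normal integer_group" unfolding finite_index_normal_def by blast
next
  assume "N \<in> finite_index_normal integer_group"
  then have N: "N \<lhd> integer_group" and fin: "finite (rcosets\<^bsub>integer_group\<^esub> N)"
    unfolding finite_index_normal_def by auto
  interpret N: normal N integer_group by (rule N)
  have add: "a + b \<in> N" if "a \<in> N" "b \<in> N" for a b using subgroup.m_closed[OF N.is_subgroup that] by simp
  have neg: "- a \<in> N" if "a \<in> N" for a using subgroup.m_inv_closed[OF N.is_subgroup that] by simp
  have zero: "0 \<in> N" using subgroup.one_closed[OF N.is_subgroup] by simp
  have "\<not> inj (\<lambda>i. N #>\<^bsub>integer_group\<^esub> int i)"
  proof
    assume "inj (\<lambda>i. N #>\<^bsub>integer_group\<^esub> int i)"
    moreover have "range (\<lambda>i. N #>\<^bsub>integer_group\<^esub> int i) \<subseteq> rcosets\<^bsub>integer_group\<^esub> N"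
      unfolding RCOSETS_def by auto
    ultimately show False using fin by (meson finite_subset range_inj_infinite)
  qed
  then obtain i j where ij: "i < j" "N #>\<^bsub>integer_group\<^esub> int i = N #>\<^bsub>integer_group\<^esub> int j"
    unfolding inj_def by (metis linorder_neqE_nat)
  have "int j \<in> N #>\<^bsub>integer_group\<^esub> int i"
    unfolding ij(2) using zero by (simp add: mem_r_coset_integer_group)
  then have "int j - int i \<in> N" by (simp add: mem_r_coset_integer_group)
  then have ex: "0 < j - i \<and> int (j - i) \<in> N" using ij by (simp add: of_nat_diff)
  \<comment> \<open>The least positive element generates the subgroup, by division with remainder.\<close>
  define n where "n = (LEAST n. 0 < n \<and> int n \<in> N)"
  have n: "0 < n" "int n \<in> N" using LeastI[where P="\<lambda>n. 0 < n \<and> int n \<in> N", OF ex] unfolding n_def by auto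
  have nat_mult: "int k * int n \<in> N" for k
    by (induction k) (auto simp: zero distrib_right intro: add n)
  have mult: "k * int n \<in> N" for k :: int
  proof (cases "k \<ge> 0")
    case True then show ?thesis using nat_mult[of "nat k"] by simp
  next
    case False then show ?thesis using neg[OF nat_mult[of "nat (- k)"]] by simp
  qed
  have "int n dvd a" if "a \<in> N" for a
  proof (rule ccontr)
    assume nd: "\<not> int n dvd a"
    have "a mod int n = a + - (a div int n) * int n" by (simp add: minus_div_mult_eq_mod[symmetric])
    then have "a mod int n \<in> N" using add[OF that mult] by metis
    moreover have "a mod int n \<noteq> 0" using nd by (simp add: dvd_eq_mod_eq_0)
    then have "0 < a mod int n" "a mod int n < int n"
      using n(1) pos_mod_sign[of "int n" a] pos_mod_bound[of "int n" a] by linarith+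
    ultimately have "0 < nat (a mod int n) \<and> int (nat (a mod int n)) \<in> N" "nat (a mod int n) < n"
      by auto
    then show False using not_less_Least unfolding n_def by blast
  qed
  then have "N = {a. int n dvd a}" using mult by (auto simp: dvd_def mult.commute)
  then show "\<exists>n>0. N = {a. n dvd a}" using n(1) by (intro exI[of _ "int n"]) auto
qed

lemma multiples_inject:
  assumes "m > 0" "n > 0" "{a. m dvd a} = {a. (n::int) dvd a}"
  shows "m = n"
  using assms by (metis dvd_refl mem_Collect_eq zdvd_antisym_nonneg order_less_imp_le)

lemma mult_Zhat:
  "x \<otimes>\<^bsub>Zhat\<^esub> y = (\<lambda>N\<in>finite_index_normal integer_group. x N <#>\<^bsub>integer_group\<^esub> y N)"
  unfolding Zhat_def profinite_completion_def by (simp add: FactGroup_def)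

definition modulus :: "int set \<Rightarrow> int" where
  "modulus N = (THE n. n > 0 \<and> N = {a. n dvd a})"

lemma modulus_multiples [simp]: "n > 0 \<Longrightarrow> modulus {a. n dvd a} = n"
  unfolding modulus_def using multiples_inject by (intro the_equality) blast+

lemma
  assumes "N \<in> finite_index_normal integer_group"
  shows modulus_pos: "modulus N > 0" and modulus_dvd_iff: "modulus N dvd a \<longleftrightarrow> a \<in> N"
  using assms unfolding finite_index_normal_integer_group by auto

context torsion_free_generated_mod
begin

text \<open>
  A point of \<open>Zhat\<close> assigns to each subgroup \<open>n\<int>\<close> one of its cosets. The exponents of \<open>s\<close> in all
  coordinate vectors of \<open>x\<close> modulo \<open>n\<close> form such a coset, so it can be written down without choosing a
  coordinate vector, and compatibility between different \<open>n\<close> becomes an inclusion of sets.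
\<close>

definition to_Zhat :: "'a \<Rightarrow> 'a \<Rightarrow> int set \<Rightarrow> int set" where
  "to_Zhat s x = (\<lambda>N\<in>finite_index_normal integer_group. {c s |c. coords (modulus N) x c})"

lemma to_Zhat_eq_coset:
  assumes N: "N \<in> finite_index_normal integer_group"
    and x: "x \<in> carrier G" and s: "s \<in> S" and c: "coords (modulus N) x c"
  shows "to_Zhat s x N = N #>\<^bsub>integer_group\<^esub> c s"
proof -
  note n = modulus_pos[OF N] modulus_dvd_iff[OF N]
  have "{d s |d. coords (modulus N) x d} = {a. [a = c s] (mod modulus N)}"
  proof safe
    fix d assume "coords (modulus N) x d"
    then show "[d s = c s] (mod modulus N)" using coords_unique[OF n(1) x _ c s] by blast
  next
    fix a assume "[a = c s] (mod modulus N)"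
    then have "coords (modulus N) x (c(s := a))"
      using coords_cong[OF c, of "c(s := a)"] by (auto simp: cong_sym)
    then show "\<exists>d. a = d s \<and> coords (modulus N) x d" by (intro exI[of _ "c(s := a)"]) simp
  qed
  also have "\<dots> = N #>\<^bsub>integer_group\<^esub> c s"
    by (rule Set.set_eqI) (simp add: mem_r_coset_integer_group cong_iff_dvd_diff n(2))
  finally show ?thesis using N unfolding to_Zhat_def by simp
qed

lemma to_Zhat_mono:
  assumes M: "M \<in> finite_index_normal integer_group" and N: "N \<in> finite_index_normal integer_group"
    and "M \<subseteq> N"
  shows "to_Zhat s x M \<subseteq> to_Zhat s x N"
proof -
  have "modulus M \<in> N" using modulus_dvd_iff[OF M, of "modulus M"] \<open>M \<subseteq> N\<close> by auto
  then have "modulus N dvd modulus M" using modulus_dvd_iff[OF N] by simp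
  then show ?thesis using M N coords_mono unfolding to_Zhat_def by auto
qed

lemma to_Zhat_closed:
  assumes "x \<in> carrier G" "s \<in> S"
  shows "to_Zhat s x \<in> carrier Zhat"
proof -
  have "to_Zhat s x N \<in> carrier (integer_group Mod N)"
    if N: "N \<in> finite_index_normal integer_group" for N
  proof -
    obtain c where "coords (modulus N) x c" using ex_coords modulus_pos[OF N] assms by blast
    then show ?thesis using to_Zhat_eq_coset[OF N assms] by (auto simp: FactGroup_def RCOSETS_def)
  qed
  then show ?thesis
    using to_Zhat_mono unfolding Zhat_def profinite_completion_def
    by (auto simp: to_Zhat_def)
qed

lemma to_Zhat_hom:
  assumes s: "s \<in> S"
  shows "to_Zhat s \<in> hom G Zhat"
proof (rule homI)
  fix x y assume x: "x \<in> carrier G" and y: "y \<in> carrier G"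
  show "to_Zhat s x \<in> carrier Zhat" using to_Zhat_closed[OF x s] .
  have "to_Zhat s (x \<otimes> y) N = to_Zhat s x N <#>\<^bsub>integer_group\<^esub> to_Zhat s y N"
    if N: "N \<in> finite_index_normal integer_group" for N
  proof -
    obtain c d where c: "coords (modulus N) x c" and d: "coords (modulus N) y d"
      using ex_coords modulus_pos[OF N] x y by blast
    have "N \<lhd> integer_group" using N unfolding finite_index_normal_def by blast
    from normal.rcos_sum[OF this, of "c s" "d s"] show ?thesis
      using to_Zhat_eq_coset[OF N x s c] to_Zhat_eq_coset[OF N y s d]
        to_Zhat_eq_coset[OF N _ s coords_mult[OF c d]] x y by simp
  qed
  moreover have "to_Zhat s (x \<otimes> y) = restrict (to_Zhat s (x \<otimes> y)) (finite_index_normal integer_group)"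
    unfolding to_Zhat_def by simp
  ultimately show "to_Zhat s (x \<otimes> y) = to_Zhat s x \<otimes>\<^bsub>Zhat\<^esub> to_Zhat s y"
    unfolding mult_Zhat by (metis (no_types, lifting) restrict_ext)
qed

lemma to_Zhat_eq_if_quotient_power:
  assumes N: "N \<in> finite_index_normal integer_group"
    and xy: "x \<in> carrier G" "y \<in> carrier G" "z \<in> carrier G"
    and eq: "y = x \<otimes> z [^] modulus N" and s: "s \<in> S"
  shows "to_Zhat s y N = to_Zhat s x N"
proof -
  obtain c where c: "coords (modulus N) x c" using ex_coords modulus_pos[OF N] xy by blast
  have "coords (modulus N) y c"
    using coords_mult[OF c coords_power[OF xy(3)]] eq by simp
  then show ?thesis using to_Zhat_eq_coset[OF N _ s] xy c by simp
qed

lemma to_Zhat_separates_modulo_powers: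
  assumes x: "x \<in> carrier G" and y: "y \<in> carrier G"
    and eq: "\<And>s. s \<in> S \<Longrightarrow> to_Zhat s x = to_Zhat s y" and "n > 0"
  shows "\<exists>z\<in>carrier G. x \<otimes> inv y = z [^] (n::int)"
proof -
  define N where "N = {a. n dvd a}"
  have N: "N \<in> finite_index_normal integer_group" and m: "modulus N = n"
    using \<open>n > 0\<close> unfolding N_def finite_index_normal_integer_group by auto
  obtain c d where c: "coords n x c" and d: "coords n y d"
    using ex_coords \<open>n > 0\<close> x y by blast
  have "[c s = d s] (mod n)" if s: "s \<in> S" for s
  proof -
    have "c s \<in> to_Zhat s x N" using c N unfolding to_Zhat_def by (auto simp: m)
    then have "c s \<in> to_Zhat s y N" using eq[OF s] by simp
    then obtain e where "coords n y e" "c s = e s" using N unfolding to_Zhat_def by (auto simp: m)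
    then show ?thesis using coords_unique[OF \<open>n > 0\<close> y _ d s] by simp
  qed
  then have "coords n x d" using coords_cong[OF c] by blast
  then have "coords n (x \<otimes> inv y) (\<lambda>s. d s + - d s)" using coords_mult coords_inv[OF d] by blast
  then show ?thesis using coords_zero_imp_power[OF \<open>n > 0\<close>] x y by simp
qed

end

section \<open>Profinite groups\<close>

lemma topological_group_left_translation:
  assumes "topological_group G T" "a \<in> carrier G"
  shows "continuous_map T T (\<lambda>x. a \<otimes>\<^bsub>G\<^esub> x)"
proof -
  have "continuous_map T (prod_topology T T) (\<lambda>x. (a, x))"
    using assms by (intro continuous_map_pairedI) (auto simp: topological_group_def)
  from continuous_map_compose[OF this, of T "\<lambda>(x, y). x \<otimes>\<^bsub>G\<^esub> y"] show ?thesis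
    using assms by (simp add: topological_group_def comp_def)
qed

lemma topological_group_right_translation:
  assumes "topological_group G T" "a \<in> carrier G"
  shows "continuous_map T T (\<lambda>x. x \<otimes>\<^bsub>G\<^esub> a)"
proof -
  have "continuous_map T (prod_topology T T) (\<lambda>x. (x, a))"
    using assms by (intro continuous_map_pairedI) (auto simp: topological_group_def)
  from continuous_map_compose[OF this, of T "\<lambda>(x, y). x \<otimes>\<^bsub>G\<^esub> y"] show ?thesis
    using assms by (simp add: topological_group_def comp_def)
qed

lemma topological_group_power:
  assumes "topological_group G T"
  shows "continuous_map T T (\<lambda>x. x [^]\<^bsub>G\<^esub> (n::nat))"
proof (induction n)
  case 0
  interpret group G using assms by (simp add: topological_group_def)
  show ?case using assms by (simp add: topological_group_def)
next
  case (Suc n)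
  then have "continuous_map T (prod_topology T T) (\<lambda>x. (x [^]\<^bsub>G\<^esub> n, x))"
    by (intro continuous_map_pairedI) auto
  from continuous_map_compose[OF this, of T "\<lambda>(x, y). x \<otimes>\<^bsub>G\<^esub> y"] show ?case
    using assms by (simp add: topological_group_def comp_def nat_pow_Suc)
qed

lemma (in group) r_coset_eq_preimage:
  assumes "H \<subseteq> carrier G" "a \<in> carrier G"
  shows "H #> a = {x \<in> carrier G. x \<otimes> inv a \<in> H}"
proof
  show "H #> a \<subseteq> {x \<in> carrier G. x \<otimes> inv a \<in> H}"
    using assms unfolding r_coset_def by (auto simp: m_assoc subset_iff)
  show "{x \<in> carrier G. x \<otimes> inv a \<in> H} \<subseteq> H #> a"
  proof
    fix x assume x: "x \<in> {x \<in> carrier G. x \<otimes> inv a \<in> H}"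
    then have "x = x \<otimes> inv a \<otimes> a" using assms by (simp add: m_assoc)
    then show "x \<in> H #> a" using x unfolding r_coset_def by blast
  qed
qed

lemma closedin_r_coset:
  fixes G (structure)
  assumes T: "topological_group G T" and "closedin T H" "a \<in> carrier G"
  shows "closedin T (H #>\<^bsub>G\<^esub> a)"
proof -
  interpret group G using T by (simp add: topological_group_def)
  have top: "topspace T = carrier G" using T by (simp add: topological_group_def)
  have "continuous_map T T (\<lambda>x. x \<otimes>\<^bsub>G\<^esub> inv\<^bsub>G\<^esub> a)"
    using topological_group_right_translation[OF T] assms by simp
  from closedin_continuous_map_preimage[OF this assms(2)] show ?thesis
    using r_coset_eq_preimage[of H a] closedin_subset[OF assms(2)] assms(3) top by simp
qed

lemma openin_r_coset:
  fixes G (structure)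
  assumes T: "topological_group G T" and "openin T H" "a \<in> carrier G"
  shows "openin T (H #>\<^bsub>G\<^esub> a)"
proof -
  interpret group G using T by (simp add: topological_group_def)
  have top: "topspace T = carrier G" using T by (simp add: topological_group_def)
  have "continuous_map T T (\<lambda>x. x \<otimes>\<^bsub>G\<^esub> inv\<^bsub>G\<^esub> a)"
    using topological_group_right_translation[OF T] assms by simp
  from openin_continuous_map_preimage[OF this assms(2)] show ?thesis
    using r_coset_eq_preimage[of H a] openin_subset[OF assms(2)] assms(3) top by simp
qed

lemma closed_finite_index_imp_open:
  fixes G (structure)
  assumes T: "topological_group G T" and H: "subgroup H G" "closedin T H" "finite (rcosets\<^bsub>G\<^esub> H)"
  shows "openin T H"
proof -
  interpret group G using T by (simp add: topological_group_def)
  have top: "topspace T = carrier G" using T by (simp add: topological_group_def)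
  have HR: "H \<in> rcosets H" using H(1) subgroup.subgroup_in_rcosets[OF H(1) is_group] by simp
  have "closedin T C" if "C \<in> rcosets H" for C
    using that closedin_r_coset[OF T H(2)] unfolding RCOSETS_def by auto
  then have "closedin T (\<Union>(rcosets H - {H}))"
    using H(3) by (intro closedin_Union) auto
  moreover have "\<Union>(rcosets H - {H}) = topspace T - H"
  proof -
    have "C \<inter> H = {}" if "C \<in> rcosets H - {H}" for C
      using rcos_disjoint[OF H(1)] HR that unfolding pairwise_def disjnt_def by blast
    then have "\<Union>(rcosets H - {H}) \<inter> H = {}" by blast
    moreover have "\<Union>(rcosets H - {H}) \<union> H = \<Union>(rcosets H)" using HR by blast
    ultimately show ?thesis using rcosets_part_G[OF H(1)] top by auto
  qed
  ultimately show ?thesis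
    using closedin_subset[OF H(2)] by (simp add: openin_closedin_eq)
qed

text \<open>
  In a compact Hausdorff space the connected component of a point is the intersection of the clopen sets
  that contain it.
\<close>

lemma profinite_separating_clopen:
  assumes "profinite_group G T" "x \<in> carrier G" "y \<in> carrier G" "x \<noteq> y"
  obtains U where "openin T U" "closedin T U" "x \<in> U" "y \<notin> U"
proof -
  have top: "topspace T = carrier G" and "compact_space T" "Hausdorff_space T"
    and td: "\<And>C. connectedin T C \<Longrightarrow> \<exists>x. C \<subseteq> {x}"
    using assms(1) by (auto simp: profinite_group_def topological_group_def totally_disconnected_space_def)
  then have "quasi_component_of T x y = connected_component_of T x y"
    using quasi_eq_connected_components_of[of T] quasi_eq_connected_components_of_pointwise_alt[of T]
    by metis
  moreover have "\<not> connected_component_of T x y"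
    using td \<open>x \<noteq> y\<close> unfolding connected_component_of_def by blast
  ultimately show ?thesis
    using assms(2,3) top that unfolding quasi_component_of by blast
qed

text \<open>
  The elements \<open>h\<close> with \<open>h U \<subseteq> U\<close> and \<open>inv h U \<subseteq> U\<close> form a subgroup contained in \<open>U\<close>.
  It is open because the set of \<open>h\<close> with \<open>h U \<subseteq> U\<close> is the complement of the projection of a closed
  set along a compact factor.
\<close>

lemma profinite_open_subgroup_within:
  fixes G (structure)
  assumes G: "profinite_group G T" and U: "openin T U" "closedin T U" and one: "\<one>\<^bsub>G\<^esub> \<in> U"
  obtains W where "subgroup W G" "openin T W" "W \<subseteq> U"
proof -
  have T: "topological_group G T" and cpt: "compact_space T" and top: "topspace T = carrier G"
    using G by (auto simp: profinite_group_def topological_group_def)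
  interpret group G using T by (simp add: topological_group_def)
  have UG: "U \<subseteq> carrier G" using U openin_subset top by blast
  define V where "V = {h \<in> carrier G. \<forall>u\<in>U. h \<otimes> u \<in> U}"
  define K where "K = {z \<in> topspace (prod_topology T T). (\<lambda>(x, y). x \<otimes> y) z \<in> topspace T - U} \<inter>
    {z \<in> topspace (prod_topology T T). snd z \<in> U}"
  have "closedin T (topspace T - U)" using U by blast
  then have "closedin (prod_topology T T) K"
    unfolding K_def using U T unfolding topological_group_def
    by (intro closedin_Int closedin_continuous_map_preimage[where Y=T] continuous_map_snd) simp_all
  then have "closedin T (fst ` K)"
    using Abstract_Topological_Spaces.closed_map_fst[OF cpt] unfolding closed_map_def by blast
  moreover have "V = topspace T - fst ` K"
  proof -
    have K: "(h, u) \<in> K \<longleftrightarrow> h \<in> carrier G \<and> u \<in> U \<and> h \<otimes> u \<notin> U" for h u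
      using UG by (auto simp: K_def top)
    have "fst ` K = {h. \<exists>u. (h, u) \<in> K}" by force
    then show ?thesis unfolding V_def top K by blast
  qed
  ultimately have V: "openin T V" by blast
  define W where "W = {h \<in> topspace T. h \<in> V \<and> inv h \<in> V}"
  have "W = V \<inter> {h \<in> topspace T. inv h \<in> V}" using openin_subset[OF V] unfolding W_def by blast
  moreover have "openin T {h \<in> topspace T. inv h \<in> V}"
    using T V by (intro openin_continuous_map_preimage[where Y=T]) (auto simp: topological_group_def)
  ultimately have "openin T W" using V by auto
  moreover have "subgroup W G"
  proof (rule subgroupI)
    show "W \<subseteq> carrier G" unfolding W_def top by blast
    have "\<one> \<in> W" using UG by (auto simp: W_def V_def top)
    then show "W \<noteq> {}" by blast
    show "inv a \<in> W" if "a \<in> W" for a using that by (auto simp: W_def top)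
    show "a \<otimes> b \<in> W" if "a \<in> W" "b \<in> W" for a b
      using that UG by (auto simp: W_def V_def top m_assoc inv_mult_group subset_iff)
  qed
  moreover have "W \<subseteq> U"
  proof
    fix h assume "h \<in> W"
    then have "h \<in> carrier G" "h \<otimes> \<one> \<in> U" using one by (auto simp: W_def V_def)
    then show "h \<in> U" by simp
  qed
  ultimately show ?thesis using that by blast
qed

text \<open>
  Finitely many cosets of \<open>W\<close> cover the group, so two of the powers \<open>1, y, y\<^sup>2, \<dots>\<close> with bounded
  exponent lie in the same one, and some power of \<open>y\<close> with bounded positive exponent lies in \<open>W\<close>. A
  factorial is a multiple of all these exponents and therefore works for every \<open>y\<close>.
\<close>

lemma compact_group_open_subgroup_exponent:
  fixes G (structure)
  assumes T: "topological_group G T" "compact_space T" and W: "subgroup W G" "openin T W"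
  obtains n :: nat where "n > 0" "\<And>y. y \<in> carrier G \<Longrightarrow> y [^]\<^bsub>G\<^esub> n \<in> W"
proof -
  interpret group G using T by (simp add: topological_group_def)
  have top: "topspace T = carrier G" using T by (simp add: topological_group_def)
  interpret W: subgroup W G by (rule W)
  have "openin T C" if "C \<in> rcosets W" for C
    using that openin_r_coset[OF T(1) W(2)] unfolding RCOSETS_def by auto
  moreover have "topspace T = \<Union>(rcosets W)" using rcosets_part_G[OF W(1)] top by simp
  ultimately obtain \<F> where F: "finite \<F>" "\<F> \<subseteq> rcosets W" "carrier G \<subseteq> \<Union>\<F>"
    using T(2) top unfolding compact_space_alt by (metis subset_refl)
  have "y [^] (fact (card \<F>) :: nat) \<in> W" if y: "y \<in> carrier G" for y
  proof -
    have "\<forall>i::nat. \<exists>C\<in>\<F>. y [^] i \<in> C" using F(3) y by (meson UnionE nat_pow_closed subset_eq)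
    then obtain C where C: "\<And>i::nat. C i \<in> \<F>" "\<And>i. y [^] i \<in> C i" by metis
    have "\<not> inj_on C {..card \<F>}"
    proof
      assume "inj_on C {..card \<F>}"
      then have "card {..card \<F>} \<le> card \<F>" using C(1) F(1) by (intro card_inj_on_le) auto
      then show False by simp
    qed
    then obtain i j where ij: "i < j" "j \<le> card \<F>" "C i = C j"
      unfolding inj_on_def by (metis atMost_iff linorder_neqE_nat)
    obtain a where a: "a \<in> carrier G" "C j = W #> a"
      using C(1)[of j] F(2) unfolding RCOSETS_def by auto
    have "y [^] j \<otimes> inv (y [^] i) \<in> W"
    proof -
      have "y [^] i \<otimes> inv a \<in> W" "y [^] j \<otimes> inv a \<in> W"
        using C(2)[of i] C(2)[of j] ij a r_coset_eq_preimage[OF W.subset a(1)] by auto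
      then have "(y [^] j \<otimes> inv a) \<otimes> inv (y [^] i \<otimes> inv a) \<in> W" by blast
      moreover have "(y [^] j \<otimes> inv a) \<otimes> inv (y [^] i \<otimes> inv a) = y [^] j \<otimes> inv (y [^] i)"
        using y a by (simp add: inv_mult_group m_assoc[symmetric] inv_solve_right')
          (simp add: m_assoc)
      ultimately show ?thesis by simp
    qed
    moreover have "y [^] j = y [^] (j - i) \<otimes> y [^] i"
      using ij y by (simp add: nat_pow_mult)
    ultimately have "y [^] (j - i) \<in> W" using y by (simp add: m_assoc)
    moreover have "(j - i) dvd fact (card \<F>)" using ij by (intro dvd_fact) auto
    then obtain k where "fact (card \<F>) = (j - i) * k" by (auto simp: dvd_def)
    ultimately show ?thesis
      using y subgroup_int_pow_closed[OF W(1), of "y [^] (j - i)" "int k"]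
      by (simp add: nat_pow_pow int_pow_int)
  qed
  moreover have "(fact (card \<F>) :: nat) > 0" by simp
  ultimately show ?thesis using that by blast
qed

text \<open>
  An element with roots of all orders lies in every open subgroup, by the preceding lemma, and open
  subgroups separate points from the identity.
\<close>

lemma profinite_infinitely_divisible_imp_one:
  fixes G (structure)
  assumes G: "profinite_group G T" and x: "x \<in> carrier G"
    and div: "\<And>n::nat. n > 0 \<Longrightarrow> \<exists>y\<in>carrier G. x = y [^]\<^bsub>G\<^esub> n"
  shows "x = \<one>\<^bsub>G\<^esub>"
proof (rule ccontr)
  assume ne: "x \<noteq> \<one>\<^bsub>G\<^esub>"
  interpret group G using G by (simp add: profinite_group_def topological_group_def)
  obtain U where U: "openin T U" "closedin T U" "\<one> \<in> U" "x \<notin> U"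
    using profinite_separating_clopen[OF G one_closed x] ne by metis
  obtain W where W: "subgroup W G" "openin T W" "W \<subseteq> U"
    using profinite_open_subgroup_within[OF G U(1-3)] by blast
  obtain n :: nat where "n > 0" "\<And>y. y \<in> carrier G \<Longrightarrow> y [^] n \<in> W"
    using compact_group_open_subgroup_exponent[OF _ _ W(1,2)] G unfolding profinite_group_def by metis
  then have "x \<in> W" using div by blast
  then show False using W(3) U(4) by blast
qed

lemma profinite_closed_subgroup:
  fixes G (structure)
  assumes G: "profinite_group G T" and H: "subgroup H G" "closedin T H"
  shows "profinite_group (G\<lparr>carrier := H\<rparr>) (subtopology T H)"
proof -
  have T: "topological_group G T" and top: "topspace T = carrier G"
    using G by (auto simp: profinite_group_def topological_group_def)
  interpret group G using T by (simp add: topological_group_def)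
  interpret H: subgroup H G by (rule H)
  have "continuous_map (prod_topology (subtopology T H) (subtopology T H)) (subtopology T H) (\<lambda>(x, y). x \<otimes> y)"
    unfolding prod_topology_subtopology continuous_map_in_subtopology
    using T by (auto simp: topological_group_def subtopology_subtopology intro!: continuous_map_from_subtopology)
  moreover have "continuous_map (subtopology T H) (subtopology T H) (\<lambda>x. inv\<^bsub>G\<lparr>carrier := H\<rparr>\<^esub> x)"
  proof -
    have "continuous_map (subtopology T H) (subtopology T H) (\<lambda>x. inv x)"
      unfolding continuous_map_in_subtopology
      using T by (auto simp: topological_group_def intro!: continuous_map_from_subtopology)
    then show ?thesis by (rule continuous_map_eq) (simp add: m_inv_consistent[OF H(1)])
  qed
  ultimately have "topological_group (G\<lparr>carrier := H\<rparr>) (subtopology T H)"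
    using H.subgroup_is_group[OF is_group] top H.subset unfolding topological_group_def by auto
  then show ?thesis
    using G H(2) Hausdorff_space_subtopology closedin_compact_space compact_space_subtopology
    unfolding profinite_group_def totally_disconnected_space_def
    by (metis connectedin_subtopology)
qed

lemma (in comm_group) powers_subgroup: "subgroup ((\<lambda>y. y [^] (n::nat)) ` carrier G) G"
proof (rule subgroupI)
  show "inv a \<in> (\<lambda>y. y [^] n) ` carrier G" if "a \<in> (\<lambda>y. y [^] n) ` carrier G" for a
    using that by (auto simp: nat_pow_inv[symmetric])
  show "a \<otimes> b \<in> (\<lambda>y. y [^] n) ` carrier G"
    if "a \<in> (\<lambda>y. y [^] n) ` carrier G" "b \<in> (\<lambda>y. y [^] n) ` carrier G" for a b
    using that by (auto simp: nat_pow_distrib[symmetric])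
qed auto

text \<open>
  The subgroup \<open>G\<^sup>n\<close> is a continuous image of a compact space, hence closed. The union of the
  finitely many cosets of \<open>G\<^sup>n\<close> that are represented by monomials in \<open>S\<close> with exponents below \<open>n\<close> is
  closed too, and it contains the dense subgroup generated by \<open>S\<close>; so it is everything, and \<open>G\<^sup>n\<close>
  has finite index.
\<close>

lemma
  fixes G (structure)
  assumes T: "topological_group G T" "compact_space T" "Hausdorff_space T" and comm: "comm_group G"
    and S: "finite S" "S \<subseteq> carrier G" "T closure_of (generate G S) = carrier G" and n: "n > 0"
  shows compact_abelian_generates_mod_powers:
      "x \<in> carrier G \<Longrightarrow> \<exists>c. \<exists>y\<in>carrier G. x = comm_group.monomial G S c \<otimes>\<^bsub>G\<^esub> y [^]\<^bsub>G\<^esub> (n::nat)"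
    and compact_abelian_openin_powers: "openin T ((\<lambda>y. y [^]\<^bsub>G\<^esub> n) ` carrier G)"
proof -
  interpret comm_group G by (rule comm)
  have top: "topspace T = carrier G" using T by (simp add: topological_group_def)
  define P where "P = (\<lambda>y. y [^] n) ` carrier G"
  have PG: "subgroup P G" unfolding P_def by (rule powers_subgroup)
  have P: "closedin T P"
    using continuous_imp_closed_map[OF topological_group_power[OF T(1)] T(2,3), of n] top
    unfolding P_def closed_map_def by (metis closedin_topspace)
  define E where "E = S \<rightarrow>\<^sub>E {0..<int n}"
  have "finite E" unfolding E_def using S(1) by (intro finite_PiE) auto
  define K where "K = (\<Union>e\<in>E. P #> monomial S e)"
  have "closedin T K"
    unfolding K_def using \<open>finite E\<close> P S(2) closedin_r_coset[OF T(1)]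
    by (intro closedin_Union finite_imageI) auto
  moreover have "generate G S \<subseteq> K"
  proof
    fix x assume "x \<in> generate G S"
    then obtain c where x: "x = monomial S c" using generate_subset_monomials[OF S(1,2)] by blast
    define e where "e = (\<lambda>s\<in>S. c s mod int n)"
    have "e \<in> E" unfolding E_def e_def using n by auto
    have "x = monomial S (\<lambda>s. (c s div int n) * int n + e s)"
      unfolding x e_def using S(2) by (intro monomial_cong) auto
    also have "\<dots> = (monomial S (\<lambda>s. c s div int n)) [^] n \<otimes> monomial S e"
      using S by (simp add: monomial_add monomial_mult int_pow_int)
    finally have "x \<in> P #> monomial S e" unfolding P_def r_coset_def using S(2) by auto
    then show "x \<in> K" unfolding K_def using \<open>e \<in> E\<close> by blast
  qed
  ultimately have "T closure_of generate G S \<subseteq> K" by (simp add: closure_of_minimal)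
  then have KG: "carrier G \<subseteq> K" using S(3) by simp
  show "\<exists>c. \<exists>y\<in>carrier G. x = monomial S c \<otimes> y [^] n" if "x \<in> carrier G"
  proof -
    have "x \<in> K" using KG that by blast
    then obtain e where "x \<in> P #> monomial S e" unfolding K_def by (rule UN_E)
    then obtain y where y: "y \<in> carrier G" "x = y [^] n \<otimes> monomial S e" unfolding P_def r_coset_def by auto
    then have "x = monomial S e \<otimes> y [^] n" using S(2) by (simp add: m_comm)
    then show ?thesis using y by blast
  qed
  have "rcosets P \<subseteq> (\<lambda>e. P #> monomial S e) ` E"
  proof
    fix C assume "C \<in> rcosets P"
    then obtain a where a: "a \<in> carrier G" "C = P #> a" unfolding RCOSETS_def by auto
    then have "a \<in> K" using KG by blast
    then obtain e where e: "e \<in> E" "a \<in> P #> monomial S e" unfolding K_def by (rule UN_E)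
    then have "P #> monomial S e = P #> a" using repr_independence[OF e(2)] PG S(2) by simp
    then show "C \<in> (\<lambda>e. P #> monomial S e) ` E" using a e by blast
  qed
  then have "finite (rcosets P)" using \<open>finite E\<close> finite_surj by blast
  then show "openin T ((\<lambda>y. y [^] n) ` carrier G)"
    using closed_finite_index_imp_open[OF T(1) PG P] unfolding P_def by blast
qed

section \<open>Separating torsion-free abelian profinite groups by the profinite integers\<close>

lemma locally_constant_imp_continuous_discrete:
  assumes "f \<in> topspace T \<rightarrow> Y"
    and "\<And>x. x \<in> topspace T \<Longrightarrow> \<exists>U. openin T U \<and> x \<in> U \<and> (\<forall>y\<in>U. f y = f x)"
  shows "continuous_map T (discrete_topology Y) f"
  unfolding continuous_map_def
proof (intro conjI allI impI)
  show "f \<in> topspace T \<rightarrow> topspace (discrete_topology Y)" using assms(1) by simp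
  fix Q
  show "openin T {x \<in> topspace T. f x \<in> Q}"
  proof (subst openin_subopen, intro ballI)
    fix x assume x: "x \<in> {x \<in> topspace T. f x \<in> Q}"
    then obtain U where U: "openin T U" "x \<in> U" "\<And>y. y \<in> U \<Longrightarrow> f y = f x"
      using assms(2)[of x] by blast
    have "U \<subseteq> {x \<in> topspace T. f x \<in> Q}"
    proof
      fix y assume "y \<in> U"
      then have "y \<in> topspace T" "f y \<in> Q" using openin_subset[OF U(1)] U(3)[of y] x by auto
      then show "y \<in> {x \<in> topspace T. f x \<in> Q}" by simp
    qed
    then show "\<exists>U. openin T U \<and> x \<in> U \<and> U \<subseteq> {x \<in> topspace T. f x \<in> Q}"
      using U by blast
  qed
qed

lemma continuous_map_Zhat:
  assumes "f \<in> topspace T \<rightarrow> carrier Zhat"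
    and "\<And>N x. N \<in> finite_index_normal integer_group \<Longrightarrow> x \<in> topspace T \<Longrightarrow>
      \<exists>U. openin T U \<and> x \<in> U \<and> (\<forall>y\<in>U. f y N = f x N)"
  shows "continuous_map T Zhat_topology f"
proof -
  have carrier: "carrier Zhat \<subseteq> (\<Pi>\<^sub>E N\<in>finite_index_normal integer_group. carrier (integer_group Mod N))"
    unfolding Zhat_def profinite_completion_def by auto
  have "continuous_map T (discrete_topology (carrier (integer_group Mod N))) (\<lambda>x. f x N)"
    if N: "N \<in> finite_index_normal integer_group" for N
    using assms(1) carrier N
    by (intro locally_constant_imp_continuous_discrete assms(2)) (auto simp: Pi_iff PiE_iff subset_iff)
  moreover have "f \<in> topspace T \<rightarrow> extensional (finite_index_normal integer_group)"
    using assms(1) carrier by (auto simp: Pi_iff PiE_def)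
  ultimately show ?thesis
    unfolding Zhat_topology_def profinite_completion_topology_def Zhat_def[symmetric]
      continuous_map_in_subtopology continuous_map_componentwise
    using assms(1) by auto
qed

text \<open>
  The homomorphism belonging to a generator \<open>s\<close> reads off the exponent of \<open>s\<close> in the coordinates. Its
  component at \<open>n\<int>\<close> is constant on the cosets of the open subgroup \<open>A\<^sup>n\<close>, which gives
  continuity. If two elements have the same images, their quotient has all coordinates zero, hence roots of
  all orders, hence is trivial.
\<close>

proposition torsion_free_fg_abelian_separated_by_Zhat:
  fixes A :: "('a, 'b) monoid_scheme"
  assumes A: "profinite_group A T" and comm: "comm_group A" and tf: "torsion_free A"
    and fg: "topologically_finitely_generated A T"
  obtains S :: "'a set" and F where "finite S" "S \<noteq> {}"
    "\<And>s. s \<in> S \<Longrightarrow> F s \<in> hom A Zhat" "\<And>s. s \<in> S \<Longrightarrow> continuous_map T Zhat_topology (F s)"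
    "\<And>x y. \<lbrakk>x \<in> carrier A; y \<in> carrier A; \<And>s. s \<in> S \<Longrightarrow> F s x = F s y\<rbrakk> \<Longrightarrow> x = y"
proof -
  have T: "topological_group A T" "compact_space T" "Hausdorff_space T" and top: "topspace T = carrier A"
    using A by (auto simp: profinite_group_def topological_group_def)
  interpret comm_group A by (rule comm)
  obtain S0 where S0: "finite S0" "S0 \<subseteq> carrier A" "T closure_of (generate A S0) = carrier A"
    using fg unfolding topologically_finitely_generated_def by blast
  \<comment> \<open>Adjoining the identity keeps the family of homomorphisms nonempty when \<open>A\<close> is trivial.\<close>
  define S where "S = insert \<one>\<^bsub>A\<^esub> S0"
  have S: "finite S" "S \<subseteq> carrier A" and "S \<noteq> {}" using S0 by (auto simp: S_def)
  have "T closure_of (generate A S0) \<subseteq> T closure_of (generate A S)"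
    by (intro closure_of_mono mono_generate) (auto simp: S_def)
  then have Sgen: "T closure_of (generate A S) = carrier A"
    using S0(3) closure_of_subset_topspace[of T] top by blast
  interpret gens: torsion_free_generated_mod A S
  proof
    show "finite S" "S \<subseteq> carrier A" by fact+
    fix x :: 'a and n :: int assume x: "x \<in> carrier A" and n: "n > 0"
    show "x = \<one>\<^bsub>A\<^esub>" if "x [^]\<^bsub>A\<^esub> n = \<one>\<^bsub>A\<^esub>"
    proof -
      have "x [^]\<^bsub>A\<^esub> nat n = \<one>\<^bsub>A\<^esub>" using that n by (simp add: int_pow_int[symmetric])
      then show ?thesis using tf x n unfolding torsion_free_def by (metis zero_less_nat_eq)
    qed
    obtain c y where "y \<in> carrier A" "x = monomial S c \<otimes>\<^bsub>A\<^esub> y [^]\<^bsub>A\<^esub> nat n"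
      using compact_abelian_generates_mod_powers[OF T comm S Sgen _ x, of "nat n"] n by auto
    then show "\<exists>c. \<exists>y\<in>carrier A. x = monomial S c \<otimes>\<^bsub>A\<^esub> y [^]\<^bsub>A\<^esub> n"
      using n by (metis int_nat_eq int_pow_int order_less_imp_le)
  qed
  have cont: "continuous_map T Zhat_topology (gens.to_Zhat s)" if s: "s \<in> S" for s
  proof (rule continuous_map_Zhat)
    show "gens.to_Zhat s \<in> topspace T \<rightarrow> carrier Zhat" using gens.to_Zhat_closed s top by auto
    fix N x assume N: "N \<in> finite_index_normal integer_group" and x: "x \<in> topspace T"
    define n where "n = nat (modulus N)"
    have n: "n > 0" "modulus N = int n" using modulus_pos[OF N] by (auto simp: n_def)
    let ?U = "(\<lambda>y. y [^]\<^bsub>A\<^esub> n) ` carrier A #>\<^bsub>A\<^esub> x"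
    have "openin T ?U"
      using openin_r_coset[OF T(1) compact_abelian_openin_powers[OF T comm S Sgen n(1)]] x top by simp
    moreover have "x \<in> ?U"
      using rcos_self[OF _ powers_subgroup] x top by simp
    moreover have "gens.to_Zhat s y N = gens.to_Zhat s x N" if y: "y \<in> ?U" for y
    proof -
      obtain z where z: "z \<in> carrier A" "y = z [^]\<^bsub>A\<^esub> n \<otimes>\<^bsub>A\<^esub> x" using y unfolding r_coset_def by auto
      then have "y = x \<otimes>\<^bsub>A\<^esub> z [^]\<^bsub>A\<^esub> modulus N" using x top by (simp add: n int_pow_int m_comm)
      then show ?thesis using gens.to_Zhat_eq_if_quotient_power[OF N] x top z s by auto
    qed
    ultimately show "\<exists>U. openin T U \<and> x \<in> U \<and> (\<forall>y\<in>U. gens.to_Zhat s y N = gens.to_Zhat s x N)" by blast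
  qed
  have sep: "x = y" if x: "x \<in> carrier A" and y: "y \<in> carrier A"
    and eq: "\<And>s. s \<in> S \<Longrightarrow> gens.to_Zhat s x = gens.to_Zhat s y" for x y
  proof -
    have "x \<otimes>\<^bsub>A\<^esub> inv\<^bsub>A\<^esub> y = \<one>\<^bsub>A\<^esub>"
    proof (rule profinite_infinitely_divisible_imp_one[OF A])
      fix n :: nat assume "n > 0"
      then show "\<exists>z\<in>carrier A. x \<otimes>\<^bsub>A\<^esub> inv\<^bsub>A\<^esub> y = z [^]\<^bsub>A\<^esub> n"
        using gens.to_Zhat_separates_modulo_powers[OF x y eq, of "int n"] by (simp add: int_pow_int)
    qed (use x y in auto)
    then show ?thesis using x y inv_equality by fastforce
  qed
  show ?thesis
  proof (rule that[where S=S and F=gens.to_Zhat])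
    show "gens.to_Zhat s \<in> hom A Zhat" if "s \<in> S" for s by (rule gens.to_Zhat_hom[OF that])
    show "continuous_map T Zhat_topology (gens.to_Zhat s)" if "s \<in> S" for s by (rule cont[OF that])
    show "x = y" if "x \<in> carrier A" "y \<in> carrier A" "\<And>s. s \<in> S \<Longrightarrow> gens.to_Zhat s x = gens.to_Zhat s y" for x y
      using sep that by blast
  qed (fact S(1) \<open>S \<noteq> {}\<close>)+
qed

section \<open>Inducing from a subgroup of finite index\<close>

locale finite_index_subgroup = group G for G (structure) +
  fixes A
  assumes subgroup: "subgroup A G" and finite_index: "finite (rcosets A)"
begin

definition rep :: "'a set \<Rightarrow> 'a" where
  "rep C = (SOME u. u \<in> C)"

lemma coset_subset: "C \<in> rcosets A \<Longrightarrow> C \<subseteq> carrier G"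
  using rcosets_part_G[OF subgroup] by blast

lemma subset_carrier: "A \<subseteq> carrier G"
  using subgroup subgroup.subset by blast

lemma
  assumes "C \<in> rcosets A"
  shows rep_closed: "rep C \<in> carrier G" and r_coset_rep: "A #> rep C = C"
proof -
  have 1: "rep C \<in> C"
    using subgroup.rcosets_non_empty[OF subgroup assms] unfolding rep_def by (meson ex_in_conv someI)
  then show "rep C \<in> carrier G" using coset_subset[OF assms] by blast
  obtain a where "a \<in> carrier G" "C = A #> a" using assms unfolding RCOSETS_def by auto
  then show "A #> rep C = C" using 1 repr_independence[OF _ _ subgroup] by metis
qed

lemma r_coset_translate:
  assumes "C \<in> rcosets A" "x \<in> carrier G"
  shows "C #> x \<in> rcosets A"
  using assms coset_mult_assoc[OF subset_carrier rep_closed[OF assms(1)] assms(2)]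
    r_coset_rep[OF assms(1)] rep_closed[OF assms(1)] rcosetsI[OF subset_carrier] by (metis m_closed)

lemma r_coset_translate_eq_iff:
  assumes "C \<in> rcosets A" "D \<in> rcosets A" "x \<in> carrier G"
  shows "C #> x = D \<longleftrightarrow> rep C \<otimes> x \<in> D"
proof -
  have eq: "C #> x = A #> (rep C \<otimes> x)"
    using coset_mult_assoc[OF subset_carrier rep_closed[OF assms(1)] assms(3)] r_coset_rep[OF assms(1)] by simp
  have "A #> (rep C \<otimes> x) = D" if "rep C \<otimes> x \<in> D"
    using repr_independence[of "rep C \<otimes> x" A "rep D"] r_coset_rep[OF assms(2)] rep_closed[OF assms(2)]
      subgroup that by simp
  moreover have "rep C \<otimes> x \<in> A #> (rep C \<otimes> x)"
    using rcos_self[OF _ subgroup] rep_closed[OF assms(1)] assms(3) by simp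
  ultimately show ?thesis using eq by metis
qed

text \<open>
  The defining relation is \<open>rep C \<otimes> x = cocycle C x \<otimes> rep (C #> x)\<close>: moving the chosen
  representative of a coset by \<open>x\<close> gives the representative of the new coset up to an element of \<open>A\<close>.
\<close>

definition cocycle :: "'a set \<Rightarrow> 'a \<Rightarrow> 'a" where
  "cocycle C x = rep C \<otimes> x \<otimes> inv (rep (C #> x))"

lemma cocycle_closed:
  assumes "C \<in> rcosets A" "x \<in> carrier G"
  shows "cocycle C x \<in> A"
proof -
  note D = r_coset_translate[OF assms]
  have "rep C \<otimes> x \<in> C #> x" using r_coset_translate_eq_iff[OF assms(1) D assms(2)] by simp
  then have "rep C \<otimes> x \<in> A #> rep (C #> x)" using r_coset_rep[OF D] by simp
  then show ?thesis
    using r_coset_eq_preimage[OF subset_carrier rep_closed[OF D]] unfolding cocycle_def by simp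
qed

lemma cocycle_mult:
  assumes C: "C \<in> rcosets A" and x: "x \<in> carrier G" and y: "y \<in> carrier G"
  shows "cocycle C (x \<otimes> y) = cocycle C x \<otimes> cocycle (C #> x) y"
proof -
  note D = r_coset_translate[OF C x]
  note cl = rep_closed[OF C] rep_closed[OF D] rep_closed[OF r_coset_translate[OF D y]]
  have "C #> (x \<otimes> y) = C #> x #> y" using coset_mult_assoc[OF coset_subset[OF C] x y] by simp
  then have "cocycle C (x \<otimes> y) = rep C \<otimes> x \<otimes> (y \<otimes> inv (rep (C #> x #> y)))"
    unfolding cocycle_def using x y cl by (simp add: m_assoc)
  also have "y \<otimes> inv (rep (C #> x #> y)) = inv (rep (C #> x)) \<otimes> (rep (C #> x) \<otimes> y \<otimes> inv (rep (C #> x #> y)))"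
    using y cl by (simp add: m_assoc[symmetric])
  finally show ?thesis unfolding cocycle_def using x y cl by (simp add: m_assoc)
qed

lemma openin_translate_eq:
  assumes T: "topological_group G T" and A: "openin T A"
    and C: "C \<in> rcosets A" and D: "D \<in> rcosets A"
  shows "openin T {x \<in> carrier G. C #> x = D}"
proof -
  have top: "topspace T = carrier G" using T by (simp add: topological_group_def)
  have "openin T D" using openin_r_coset[OF T A rep_closed[OF D]] r_coset_rep[OF D] by simp
  with topological_group_left_translation[OF T rep_closed[OF C]]
  have "openin T {x \<in> topspace T. rep C \<otimes> x \<in> D}" by (rule openin_continuous_map_preimage)
  moreover have "{x \<in> topspace T. rep C \<otimes> x \<in> D} = {x \<in> carrier G. C #> x = D}"
    using r_coset_translate_eq_iff[OF C D] top by blast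
  ultimately show ?thesis by simp
qed

text \<open>
  On the open set where \<open>C #> x\<close> is a fixed coset the cocycle is a two-sided translation.
\<close>

lemma continuous_map_cocycle:
  assumes T: "topological_group G T" and A: "openin T A" and C: "C \<in> rcosets A"
    and h: "continuous_map (subtopology T A) Y h"
  shows "continuous_map T Y (\<lambda>x. h (cocycle C x))"
proof (rule pasting_lemma[where I = "rcosets A" and T = "\<lambda>D. {x \<in> carrier G. C #> x = D}"
      and f = "\<lambda>D x. h (rep C \<otimes> x \<otimes> inv (rep D))"])
  have top: "topspace T = carrier G" using T by (simp add: topological_group_def)
  fix D assume D: "D \<in> rcosets A"
  show "openin T {x \<in> carrier G. C #> x = D}" by (rule openin_translate_eq[OF T A C D])
  have "continuous_map T T ((\<lambda>x. x \<otimes> inv (rep D)) \<circ> (\<lambda>x. rep C \<otimes> x))"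
    using topological_group_left_translation[OF T rep_closed[OF C]]
      topological_group_right_translation[OF T inv_closed[OF rep_closed[OF D]]]
    by (rule continuous_map_compose)
  then have "continuous_map (subtopology T {x \<in> carrier G. C #> x = D}) (subtopology T A)
      (\<lambda>x. rep C \<otimes> x \<otimes> inv (rep D))"
    using cocycle_closed[OF C] unfolding continuous_map_in_subtopology comp_def cocycle_def
    by (auto intro: continuous_map_from_subtopology)
  from continuous_map_compose[OF this h]
  show "continuous_map (subtopology T {x \<in> carrier G. C #> x = D}) Y (\<lambda>x. h (rep C \<otimes> x \<otimes> inv (rep D)))"
    by (simp add: comp_def)
next
  fix x assume "x \<in> topspace T"
  then have "x \<in> carrier G" using T by (simp add: topological_group_def)
  then show "\<exists>D. D \<in> rcosets A \<and> x \<in> {x \<in> carrier G. C #> x = D} \<and>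
      h (cocycle C x) = h (rep C \<otimes> x \<otimes> inv (rep D))"
    using r_coset_translate[OF C] unfolding cocycle_def by blast
qed auto

end

text \<open>
  The monomial representation induced by homomorphisms \<open>F s\<close> from \<open>A\<close> to \<open>Zhat\<close>: the positions
  \<open>1, \<dots>, N\<close> are identified with pairs of a homomorphism and a right coset of \<open>A\<close>; the group permutes
  the cosets, and the entries are the values of the homomorphisms on the cocycle.
\<close>

locale induced_map = finite_index_subgroup G A for G (structure) and A +
  fixes S :: "'s set" and F :: "'s \<Rightarrow> 'a \<Rightarrow> int set \<Rightarrow> int set" and enum :: "nat \<Rightarrow> 's \<times> 'a set" and N :: nat
  assumes F_hom: "\<And>s. s \<in> S \<Longrightarrow> F s \<in> hom (G\<lparr>carrier := A\<rparr>) Zhat"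
    and enum: "bij_betw enum {1..N} (S \<times> rcosets A)"
begin

definition index :: "'s \<times> 'a set \<Rightarrow> nat" where
  "index = inv_into {1..N} enum"

lemma index: "z \<in> S \<times> rcosets A \<Longrightarrow> index z \<in> {1..N}" "z \<in> S \<times> rcosets A \<Longrightarrow> enum (index z) = z"
  using enum unfolding index_def bij_betw_def by (metis inv_into_into, metis f_inv_into_f)

lemma index_enum: "i \<in> {1..N} \<Longrightarrow> index (enum i) = i"
  using enum unfolding index_def bij_betw_def by (simp add: inv_into_f_f)

lemma enum_cases:
  assumes "i \<in> {1..N}"
  obtains s C where "s \<in> S" "C \<in> rcosets A" "enum i = (s, C)" "i = index (s, C)"
  using assms enum index_enum unfolding bij_betw_def by (metis imageI mem_Sigma_iff surj_pair)

text \<open>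
  Right multiplication by the inverse turns the action on right cosets into a left action, to match the
  composition of permutations.
\<close>

definition perm :: "'a \<Rightarrow> nat \<Rightarrow> nat" where
  "perm x i = (if i \<in> {1..N} then index (fst (enum i), snd (enum i) #> inv x) else i)"

definition entries :: "'a \<Rightarrow> nat \<Rightarrow> int set \<Rightarrow> int set" where
  "entries x = (\<lambda>i\<in>{1..N}. F (fst (enum i)) (cocycle (snd (enum i)) x))"

lemma perm_index:
  assumes "s \<in> S" "C \<in> rcosets A"
  shows "perm x (index (s, C)) = index (s, C #> inv x)"
  using assms index by (simp add: perm_def)

lemma entries_index:
  assumes "s \<in> S" "C \<in> rcosets A"
  shows "entries x (index (s, C)) = F s (cocycle C x)"
  using assms index[of "(s, C)"] by (simp add: entries_def)

lemma perm_outside: "i \<notin> {1..N} \<Longrightarrow> perm x i = i"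
  by (auto simp: perm_def)

lemma perm_mult:
  assumes x: "x \<in> carrier G" and y: "y \<in> carrier G"
  shows "perm (x \<otimes> y) = perm x \<circ> perm y"
proof
  fix i
  show "perm (x \<otimes> y) i = (perm x \<circ> perm y) i"
  proof (cases "i \<in> {1..N}")
    case True
    then obtain s C where i: "s \<in> S" "C \<in> rcosets A" "i = index (s, C)" using enum_cases by metis
    have "C #> inv y \<in> rcosets A" using r_coset_translate i(2) y by simp
    moreover have "C #> inv (x \<otimes> y) = C #> inv y #> inv x"
      using coset_mult_assoc[OF coset_subset[OF i(2)], of "inv y" "inv x"] x y by (simp add: inv_mult_group)
    ultimately show ?thesis using i by (simp add: perm_index)
  qed (simp add: perm_outside)
qed

lemma perm_one: "perm \<one> = id"
proof
  fix i
  show "perm \<one> i = id i"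
  proof (cases "i \<in> {1..N}")
    case True
    then obtain s C where i: "s \<in> S" "C \<in> rcosets A" "i = index (s, C)" using enum_cases by metis
    then show ?thesis using coset_mult_one[OF coset_subset[OF i(2)]] by (simp add: perm_index)
  qed (simp add: perm_outside)
qed

lemma
  assumes x: "x \<in> carrier G"
  shows perm_permutes: "perm x permutes {1..N}" and inv_perm: "inv_into UNIV (perm x) = perm (inv x)"
proof -
  have inverse: "perm x \<circ> perm (inv x) = id" "perm (inv x) \<circ> perm x = id"
    using perm_mult[of x "inv x"] perm_mult[of "inv x" x] perm_one x by simp_all
  then show "inv_into UNIV (perm x) = perm (inv x)" by (rule inv_unique_comp)
  have "bij (perm x)" by (rule o_bij[OF inverse(2,1)])
  then show "perm x permutes {1..N}" by (simp add: permutes_def perm_outside bij_iff del: One_nat_def)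
qed

lemma entries_closed:
  assumes x: "x \<in> carrier G"
  shows "entries x \<in> {1..N} \<rightarrow>\<^sub>E carrier Zhat"
proof (rule PiE_I)
  fix i assume "i \<in> {1..N}"
  then obtain s C where i: "s \<in> S" "C \<in> rcosets A" "i = index (s, C)" using enum_cases by metis
  then show "entries x i \<in> carrier Zhat"
    using hom_in_carrier[OF F_hom[OF i(1)], of "cocycle C x"] cocycle_closed[OF i(2) x]
    by (simp add: entries_index)
qed (auto simp: entries_def)

text \<open>
  The cocycle identity \<open>cocycle C (x \<otimes> y) = cocycle C x \<otimes> cocycle (C #> x) y\<close>, read in the position of
  \<open>C\<close>; the shift from \<open>C\<close> to \<open>C #> x\<close> is the inverse of the permutation of \<open>x\<close>.
\<close>

lemma entries_mult:
  assumes x: "x \<in> carrier G" and y: "y \<in> carrier G"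
  shows "entries (x \<otimes> y) = (\<lambda>i\<in>{1..N}. entries x i \<otimes>\<^bsub>Zhat\<^esub> permute_factors N (perm x) (entries y) i)"
proof
  fix i
  show "entries (x \<otimes> y) i = (\<lambda>i\<in>{1..N}. entries x i \<otimes>\<^bsub>Zhat\<^esub> permute_factors N (perm x) (entries y) i) i"
  proof (cases "i \<in> {1..N}")
    case True
    then obtain s C where i: "s \<in> S" "C \<in> rcosets A" "i = index (s, C)" using enum_cases by metis
    have "permute_factors N (perm x) (entries y) i = entries y (perm (inv x) i)"
      using True by (simp add: permute_factors_def inv_perm[OF x])
    also have "\<dots> = F s (cocycle (C #> x) y)"
      using i x r_coset_translate[OF i(2) x] by (simp add: perm_index entries_index)
    finally have "permute_factors N (perm x) (entries y) i = F s (cocycle (C #> x) y)" .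
    moreover have "F s (cocycle C x \<otimes> cocycle (C #> x) y) = F s (cocycle C x) \<otimes>\<^bsub>Zhat\<^esub> F s (cocycle (C #> x) y)"
      using hom_mult[OF F_hom[OF i(1)], of "cocycle C x" "cocycle (C #> x) y"]
        cocycle_closed[OF i(2) x] cocycle_closed[OF r_coset_translate[OF i(2) x] y] by simp
    ultimately show ?thesis
      using True i cocycle_mult[OF i(2) x y] by (simp add: entries_index)
  qed (simp add: entries_def del: One_nat_def atLeastAtMost_iff)
qed

definition induced :: "'a \<Rightarrow> (nat \<Rightarrow> nat) \<times> (nat \<Rightarrow> int set \<Rightarrow> int set)" where
  "induced x = (perm x, entries x)"

lemma induced_hom: "induced \<in> hom G (Sigma_Zhat N)"
  by (rule homI)
    (simp_all add: induced_def Sigma_Zhat_def semidirect_product_def sym_group_carrier sym_group_mult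
      perm_permutes entries_closed perm_mult entries_mult del: One_nat_def)

text \<open>
  The permutation determines the coset \<open>A #> x\<close>, and then the entries in the positions of the trivial
  coset determine \<open>cocycle A x\<close>, because the homomorphisms separate the points of \<open>A\<close>. Coset and cocycle
  together determine \<open>x\<close>.
\<close>

lemma induced_inj:
  assumes "S \<noteq> {}"
    and sep: "\<And>a b. \<lbrakk>a \<in> A; b \<in> A; \<And>s. s \<in> S \<Longrightarrow> F s a = F s b\<rbrakk> \<Longrightarrow> a = b"
  shows "inj_on induced (carrier G)"
proof (rule inj_onI)
  fix x y assume x: "x \<in> carrier G" and y: "y \<in> carrier G" and eq: "induced x = induced y"
  have AR: "A \<in> rcosets A" using subgroup.subgroup_in_rcosets[OF subgroup is_group] .
  obtain s0 where s0: "s0 \<in> S" using assms(1) by blast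
  have "perm (inv x) = perm (inv y)" using eq x y by (simp add: induced_def inv_perm[symmetric])
  then have "perm (inv x) (index (s0, A)) = perm (inv y) (index (s0, A))" by simp
  then have "index (s0, A #> x) = index (s0, A #> y)" using s0 AR x y by (simp add: perm_index)
  then have "enum (index (s0, A #> x)) = enum (index (s0, A #> y))" by simp
  then have coset: "A #> x = A #> y"
    using s0 r_coset_translate[OF AR x] r_coset_translate[OF AR y] by (simp add: index)
  have "F s (cocycle A x) = F s (cocycle A y)" if "s \<in> S" for s
    using eq entries_index[OF that AR] unfolding induced_def by (metis prod.inject)
  then have "cocycle A x = cocycle A y" using sep cocycle_closed[OF AR] x y by blast
  then show "x = y"
    using x y rep_closed[OF AR] rep_closed[OF r_coset_translate[OF AR y]]
    unfolding cocycle_def coset by simp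
qed

lemma continuous_map_induced:
  assumes T: "topological_group G T" and A: "openin T A"
    and F: "\<And>s. s \<in> S \<Longrightarrow> continuous_map (subtopology T A) Zhat_topology (F s)"
  shows "continuous_map T (Sigma_Zhat_topology N) induced"
proof -
  have top: "topspace T = carrier G" using T by (simp add: topological_group_def)
  have "continuous_map T (discrete_topology (carrier (sym_group N))) perm"
  proof (rule locally_constant_imp_continuous_discrete)
    show "perm \<in> topspace T \<rightarrow> carrier (sym_group N)" using perm_permutes top by (simp add: sym_group_carrier)
    fix x assume "x \<in> topspace T"
    then have x: "x \<in> carrier G" using top by simp
    define U where
      "U = (\<Inter>C\<in>rcosets A. {y \<in> topspace T. inv y \<in> {z \<in> carrier G. C #> z = C #> inv x}}) \<inter> topspace T"
    have "openin T {y \<in> topspace T. inv y \<in> {z \<in> carrier G. C #> z = C #> inv x}}" if C: "C \<in> rcosets A" for C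
      using T openin_translate_eq[OF T A C r_coset_translate[OF C inv_closed[OF x]]]
      by (intro openin_continuous_map_preimage[where Y = T]) (auto simp: topological_group_def)
    then have "openin T U" unfolding U_def using finite_index by (intro openin_INT) auto
    moreover have "x \<in> U" using x top by (auto simp: U_def)
    moreover have "perm y = perm x" if y: "y \<in> U" for y
    proof
      fix i
      show "perm y i = perm x i"
      proof (cases "i \<in> {1..N}")
        case True
        then obtain s C where i: "s \<in> S" "C \<in> rcosets A" "i = index (s, C)" using enum_cases by metis
        have "C #> inv y = C #> inv x" using y i(2) by (auto simp: U_def)
        then show ?thesis using i by (simp add: perm_index)
      qed (simp add: perm_outside)
    qed
    ultimately show "\<exists>U. openin T U \<and> x \<in> U \<and> (\<forall>y\<in>U. perm y = perm x)" by blast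
  qed
  moreover have "continuous_map T (product_topology (\<lambda>_. Zhat_topology) {1..N}) entries"
    unfolding continuous_map_componentwise
  proof (intro conjI ballI)
    show "entries ` topspace T \<subseteq> extensional {1..N}" by (auto simp: entries_def)
    fix i assume "i \<in> {1..N}"
    then obtain s C where i: "s \<in> S" "C \<in> rcosets A" "i = index (s, C)" using enum_cases by metis
    show "continuous_map T Zhat_topology (\<lambda>x. entries x i)"
      using continuous_map_cocycle[OF T A i(2) F[OF i(1)]] i by (simp add: entries_index)
  qed
  ultimately show ?thesis
    unfolding Sigma_Zhat_topology_def induced_def by (rule continuous_map_pairedI)
qed

end

section \<open>The embedding\<close>

lemma Hausdorff_space_Sigma_Zhat: "Hausdorff_space (Sigma_Zhat_topology N)"
  unfolding Sigma_Zhat_topology_def Zhat_topology_def profinite_completion_topology_def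
  by (simp add: Hausdorff_space_prod_topology Hausdorff_space_product_topology Hausdorff_space_subtopology)

theorem proposition4p1:
  fixes G :: "('a, 'b) monoid_scheme" and T :: "'a topology"
  assumes "class_B G T"
  shows "\<exists>N::nat. N > 0 \<and>
    (\<exists>f. f \<in> hom G (Sigma_Zhat N) \<and>
         inj_on f (carrier G) \<and>
         continuous_map T (Sigma_Zhat_topology N) f \<and>
         embedding_map T (Sigma_Zhat_topology N) f \<and>
         closedin (Sigma_Zhat_topology N) (f ` carrier G))"
proof -
  have G: "profinite_group G T" and tf: "torsion_free G" and "virtually_fg_abelian G T"
    using assms by (auto simp: class_B_def)
  then obtain A where A: "subgroup A G" "closedin T A" "finite (rcosets\<^bsub>G\<^esub> A)"
    "comm_group (G\<lparr>carrier := A\<rparr>)" 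
    "topologically_finitely_generated (G\<lparr>carrier := A\<rparr>) (subtopology T A)"
    unfolding virtually_fg_abelian_def by blast
  have T: "topological_group G T" "compact_space T" and top: "topspace T = carrier G"
    using G by (auto simp: profinite_group_def topological_group_def)
  interpret group G using T by (simp add: topological_group_def)
  have "torsion_free (G\<lparr>carrier := A\<rparr>)"
    using tf subgroup.subset[OF A(1)] unfolding torsion_free_def
    by (auto simp: nat_pow_consistent[symmetric])
  then obtain S :: "'a set" and F where S: "finite S" "S \<noteq> {}"
    and F: "\<And>s. s \<in> S \<Longrightarrow> F s \<in> hom (G\<lparr>carrier := A\<rparr>) Zhat"
      "\<And>s. s \<in> S \<Longrightarrow> continuous_map (subtopology T A) Zhat_topology (F s)"
    and sep: "\<And>x y. \<lbrakk>x \<in> A; y \<in> A; \<And>s. s \<in> S \<Longrightarrow> F s x = F s y\<rbrakk> \<Longrightarrow> x = y"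
    using torsion_free_fg_abelian_separated_by_Zhat[OF profinite_closed_subgroup[OF G A(1,2)] A(4) _ A(5)]
    by auto
  define N where "N = card (S \<times> rcosets\<^bsub>G\<^esub> A)"
  have "finite (S \<times> rcosets\<^bsub>G\<^esub> A)" using S(1) A(3) by simp
  then obtain enum where "bij_betw enum {1..N} (S \<times> rcosets\<^bsub>G\<^esub> A)"
    unfolding N_def using ex_bij_betw_nat_finite_1 by blast
  then interpret induced_map G A S F enum N
    using A(1,3) F(1) is_group
    by (intro induced_map.intro finite_index_subgroup.intro finite_index_subgroup_axioms.intro
        induced_map_axioms.intro) auto
  have "rcosets\<^bsub>G\<^esub> A \<noteq> {}" using subgroup.subgroup_in_rcosets[OF A(1) is_group] by blast
  then have "N > 0" unfolding N_def using S A(3) by (simp add: card_gt_0_iff)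
  have cont: "continuous_map T (Sigma_Zhat_topology N) induced"
    using continuous_map_induced[OF T(1) closed_finite_index_imp_open[OF T(1) A(1-3)] F(2)] .
  have inj: "inj_on induced (carrier G)" using induced_inj[OF S(2) sep] .
  have closed: "closed_map T (Sigma_Zhat_topology N) induced"
    using T1_Spaces.continuous_imp_closed_map[OF cont T(2) Hausdorff_space_Sigma_Zhat] .
  have "embedding_map T (Sigma_Zhat_topology N) induced"
    using injective_closed_imp_embedding_map[OF cont closed] inj top by simp
  moreover have "closedin (Sigma_Zhat_topology N) (induced ` carrier G)"
    using closed top unfolding closed_map_def by (metis closedin_topspace)
  ultimately show ?thesis using \<open>N > 0\<close> induced_hom inj cont by blast
qed

end
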